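(* Let $k$ be a perfect field of characteristic $p>0$, $d\ge1$, $n\ge0$, $A=k[t_1,\dots,t_d]$, $A_{n+1}=\mathrm W_{n+1}(k)[t_1,\dots,t_d]$, $X_1=\mathrm{Spec}(A)$, $X_{n+1}=\mathrm{Spec}(A_{n+1})$. a) Any $\partial\in\mathcal D(X_1)$ admits some lifting in $\mathcal D(X_{n+1})$ of the form $$\tilde\partial=\sum_{\mathbf r}c_{\mathbf r}\,\partial_{n+1}^{[\mathbf r]},$$ where $c_{\mathbf r}\in A_{n+1}$ and $\partial_{n+1}^{[\mathbf r]}$ is obtained as product of lifts of $\partial_{j,1}^{[r_j]}$ for any $1\le j\le d$. b) Furthermore, if the restriction $\tilde\partial_{|\mathrm W_{n+1}(A)}$ to $\mathrm W_{n+1}(A)$ exists, it does not depend on the lifts of $\partial_{j,1}^{[r_j]}$, for any $j$. c) Let $\tilde\partial_1,\tilde\partial_2\in\mathcal D(X_{n+1})$ be liftings of $\partial$. Then, if the restriction of $\tilde\partial_1-\tilde\partial_2=\sum_{\mathbf r}a_{\mathbf r}\partial_{n+1}^{[\mathbf r]}$ to $\mathrm W_{n+1}(A)$ exists, it is $0$ if and only if $a_{\mathbf r}\in p^{v_p(\mathbf r)+1}A_{n+1}$ for every $\mathbf r$.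
   Context: $\mathcal D(X_{n+1})$ is Grothendieck's ring of $\mathrm W_{n+1}(k)$-linear differential operators of $A_{n+1}$ (for $n=0$: $k$-linear differential operators of $A$). $\partial_{j,1}^{[r]}=\frac1{r!}\partial_{t_j}^r$ on $A$ (i.e. $t_j^s\mapsto\binom srt_j^{s-r}$, linear in the other variables), and similarly $\partial_{j,n+1}^{[r]}$ denotes the standard operator on $A_{n+1}$. Sums over $\mathbf r=(r_1,\dots,r_d)\in\mathbb N^d$ are finite. In c), $\partial_{n+1}^{[\mathbf r]}=\partial_{1,n+1}^{[r_1]}\circ\dots\circ\partial_{d,n+1}^{[r_d]}$ is the product of the standard operators, in terms of which every element of $\mathcal D(X_{n+1})$ is uniquely a finite $A_{n+1}$-linear combination ($a_{\mathbf r}\in A_{n+1}$); in a) and b) it is a product of lifts as described there. A lift (lifting) of an operator in $\mathcal D(X_1)$ is an operator in $\mathcal D(X_{n+1})$ reducing to it modulo $p$. Let $\tilde w_n:\mathrm W_{n+1}(A)\to A_{n+1}$, $(f_1,\dots,f_{n+1})\mapsto\sum_{i=0}^np^i\tilde f_{i+1}^{\,p^{n-i}}$ ($\tilde f_i$ any lift of $f_i$ to $A_{n+1}$); it is an injective ring homomorphism. The restriction of $\delta\in\mathcal D(X_{n+1})$ to $\mathrm W_{n+1}(A)$, if it exists, is the (unique) $\mathrm W_{n+1}(k)$-linear differential operator $\delta_{|\mathrm W_{n+1}(A)}$ of $\mathrm W_{n+1}(A)$ with $\tilde w_n\circ\delta_{|\mathrm W_{n+1}(A)}=\delta\circ\tilde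 w_n$. $v_p(\mathbf r)=\min\{v_p(r_j): r_j\ne0\}$, with $v_p(\mathbf 0)=+\infty$ and $p^{+\infty}A_{n+1}=0$.
   Formalization: In a) and b) the lifts of ∂_{j,1}^{[r]} are required to belong to a Hasse–Schmidt family (E_i), i≤r, E_0=id, each E_i lifting ∂_{j,1}^{[i]}; for arbitrary lifts b) fails when n≥1, e.g. id and (1+p)id as lifts of ∂_{j,1}^{[0]}. *)

theory Defs
  imports "HOL-Library.Poly_Mapping" "HOL-Library.Extended_Nat" "HOL-Library.Numeral_Type"
    "HOL-Computational_Algebra.Computational_Algebra"
begin

section \<open>Integer polynomials and their evaluation\<close>

type_synonym ('v, 'a) pol = "('v \<Rightarrow>\<^sub>0 nat) \<Rightarrow>\<^sub>0 'a"

definition pvar :: "'v \<Rightarrow> ('v, int) pol"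
  where "pvar v = Poly_Mapping.single (Poly_Mapping.single v 1) 1"

definition mon_eval :: "('v \<Rightarrow> 'a::comm_ring_1) \<Rightarrow> ('v \<Rightarrow>\<^sub>0 nat) \<Rightarrow> 'a"
  where "mon_eval h m = (\<Prod>v\<in>Poly_Mapping.keys m. h v ^ Poly_Mapping.lookup m v)"

definition pol_eval :: "('v \<Rightarrow> 'a::comm_ring_1) \<Rightarrow> ('v, int) pol \<Rightarrow> 'a"
  where "pol_eval h P = (\<Sum>m\<in>Poly_Mapping.keys P. of_int (Poly_Mapping.lookup P m) * mon_eval h m)"

lemma pol_eval_superset:
  assumes "finite S" "Poly_Mapping.keys P \<subseteq> S"
  shows "pol_eval h P = (\<Sum>m\<in>S. of_int (Poly_Mapping.lookup P m) * mon_eval h m)"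
  unfolding pol_eval_def
  by (rule sum.mono_neutral_left) (use assms in \<open>auto simp: in_keys_iff\<close>)

lemma mon_eval_superset:
  assumes "finite S" "Poly_Mapping.keys m \<subseteq> S"
  shows "mon_eval h m = (\<Prod>v\<in>S. h v ^ Poly_Mapping.lookup m v)"
  unfolding mon_eval_def
  by (rule prod.mono_neutral_left) (use assms in \<open>auto simp: in_keys_iff\<close>)

lemma mon_eval_add: "mon_eval h (m + n) = mon_eval h m * mon_eval h n"
proof -
  let ?S = "Poly_Mapping.keys m \<union> Poly_Mapping.keys n"
  have "mon_eval h (m + n) = (\<Prod>v\<in>?S. h v ^ Poly_Mapping.lookup (m + n) v)"
    by (rule mon_eval_superset) (use Poly_Mapping.keys_add[of m n] in auto)
  also have "\<dots> = (\<Prod>v\<in>?S. h v ^ Poly_Mapping.lookup m v) * (\<Prod>v\<in>?S. h v ^ Poly_Mapping.lookup n v)"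
    by (simp add: lookup_add power_add prod.distrib)
  also have "\<dots> = mon_eval h m * mon_eval h n"
    by (subst (1 2) mon_eval_superset[of ?S]) auto
  finally show ?thesis .
qed

lemma mon_eval_0 [simp]: "mon_eval h 0 = 1"
  by (simp add: mon_eval_def)

lemma pol_eval_0 [simp]: "pol_eval h 0 = 0"
  by (simp add: pol_eval_def)

lemma pol_eval_single [simp]: "pol_eval h (Poly_Mapping.single m c) = of_int c * mon_eval h m"
  by (cases "c = 0") (simp_all add: pol_eval_def)

lemma pol_eval_pvar [simp]: "pol_eval h (pvar v) = h v"
  by (simp add: pvar_def mon_eval_def)

lemma pol_eval_add: "pol_eval h (P + Q) = pol_eval h P + pol_eval h Q"
proof -
  let ?S = "Poly_Mapping.keys P \<union> Poly_Mapping.keys Q"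
  have "pol_eval h (P + Q) = (\<Sum>m\<in>?S. of_int (Poly_Mapping.lookup (P + Q) m) * mon_eval h m)"
    by (rule pol_eval_superset) (use Poly_Mapping.keys_add[of P Q] in auto)
  also have "\<dots> = (\<Sum>m\<in>?S. of_int (Poly_Mapping.lookup P m) * mon_eval h m)
                 + (\<Sum>m\<in>?S. of_int (Poly_Mapping.lookup Q m) * mon_eval h m)"
    by (simp add: lookup_add algebra_simps sum.distrib)
  also have "\<dots> = pol_eval h P + pol_eval h Q"
    by (subst (1 2) pol_eval_superset[of ?S]) auto
  finally show ?thesis .
qed

lemma poly_mapping_sum_singles:
  fixes P :: "'b \<Rightarrow>\<^sub>0 'a::comm_monoid_add"
  shows "P = (\<Sum>m\<in>Poly_Mapping.keys P. Poly_Mapping.single m (Poly_Mapping.lookup P m))"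
  by (rule poly_mapping_eqI) (auto simp: lookup_sum lookup_single when_def in_keys_iff)

lemma pol_induct [case_names single add]:
  fixes P :: "'b \<Rightarrow>\<^sub>0 'a::comm_monoid_add"
  assumes "\<And>m c. Q (Poly_Mapping.single m c)" "\<And>f g. Q f \<Longrightarrow> Q g \<Longrightarrow> Q (f + g)"
  shows "Q P"
proof -
  have Q0: "Q 0" using assms(1)[of undefined 0] by simp
  have "finite S \<Longrightarrow> Q (\<Sum>m\<in>S. Poly_Mapping.single m (Poly_Mapping.lookup P m))" for S
    by (induction rule: finite_induct) (auto simp: Q0 assms)
  then show ?thesis
    by (subst poly_mapping_sum_singles[of P]) simp
qed

lemma pol_eval_mult: "pol_eval h (P * Q) = pol_eval h P * pol_eval h Q"
proof (induction P rule: pol_induct)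
  case (single m c)
  show ?case
    by (induction Q rule: pol_induct)
      (simp_all add: mult_single mon_eval_add distrib_left pol_eval_add)
next
  case (add f g)
  then show ?case by (simp add: distrib_right pol_eval_add)
qed

lemma pol_eval_1 [simp]: "pol_eval h 1 = 1"
  by (metis mon_eval_0 mult_1 of_int_1 pol_eval_single single_one)

lemma pol_eval_uminus: "pol_eval h (- P) = - pol_eval h P"
  using pol_eval_add[of h P "- P"] by (simp add: eq_neg_iff_add_eq_0 add.commute)

lemma pol_eval_diff: "pol_eval h (P - Q) = pol_eval h P - pol_eval h Q"
  using pol_eval_add[of h P "- Q"] by (simp add: pol_eval_uminus)

lemma pol_eval_power: "pol_eval h (P ^ i) = pol_eval h P ^ i"
  by (induction i) (simp_all add: pol_eval_mult)

lemma pol_eval_of_nat [simp]: "pol_eval h (of_nat i) = of_nat i"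
  by (induction i) (simp_all add: pol_eval_add)

lemma pol_eval_sum: "pol_eval h (sum f S) = (\<Sum>i\<in>S. pol_eval h (f i))"
  by (induction S rule: infinite_finite_induct) (simp_all add: pol_eval_add)

lemmas pol_eval_hom = pol_eval_add pol_eval_mult pol_eval_uminus pol_eval_diff pol_eval_power
  pol_eval_sum

lemma mon_eval_hom: "pol_eval h (mon_eval g m) = mon_eval (\<lambda>v. pol_eval h (g v)) m"
proof -
  have "pol_eval h (\<Prod>v\<in>S. f v) = (\<Prod>v\<in>S. pol_eval h (f v))" for S and f :: "'c \<Rightarrow> ('b, int) pol"
    by (induction S rule: infinite_finite_induct) (simp_all add: pol_eval_mult)
  then show ?thesis by (simp add: mon_eval_def pol_eval_power)
qed

lemma pol_eval_of_int [simp]: "pol_eval h (of_int i) = of_int i"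
  by (cases i rule: int_cases2) (simp_all add: pol_eval_uminus)

lemma pol_eval_pol_eval: "pol_eval h (pol_eval g P) = pol_eval (\<lambda>v. pol_eval h (g v)) P"
  by (simp add: pol_eval_def[of g] pol_eval_def[of "\<lambda>v. pol_eval h (g v)"] pol_eval_sum
      pol_eval_mult mon_eval_hom)


section \<open>Ghost components and the universal Witt vector polynomials\<close>

definition ghost :: "nat \<Rightarrow> (nat \<Rightarrow> 'a::comm_ring_1) \<Rightarrow> nat \<Rightarrow> 'a"
  where "ghost p x m = (\<Sum>i\<le>m. of_nat p ^ i * x i ^ (p ^ (m - i)))"

definition pol_div :: "int \<Rightarrow> ('v, int) pol \<Rightarrow> ('v, int) pol"
  where "pol_div c P = Poly_Mapping.map (\<lambda>a. a div c) P"

text \<open>\<open>unghost p g\<close> is the sequence of integer polynomials with ghost components \<open>g\<close>; the coefficientwise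
  division is exact in all the cases where it is used (\<open>ghost_unghost\<close> below).\<close>

function unghost :: "nat \<Rightarrow> (nat \<Rightarrow> ('v, int) pol) \<Rightarrow> nat \<Rightarrow> ('v, int) pol"
  where "unghost p g m =
    pol_div (int p ^ m) (g m - (\<Sum>i<m. of_nat p ^ i * unghost p g i ^ (p ^ (m - i))))"
  by auto
termination by (relation "measure (\<lambda>(p, g, m). m)") auto

declare unghost.simps [simp del]

definition witt_add_pol :: "nat \<Rightarrow> nat \<Rightarrow> (nat + nat, int) pol"
  where "witt_add_pol p = unghost p
    (\<lambda>m. ghost p (\<lambda>i. pvar (Inl i)) m + ghost p (\<lambda>i. pvar (Inr i)) m)"

definition witt_mult_pol :: "nat \<Rightarrow> nat \<Rightarrow> (nat + nat, int) pol"
  where "witt_mult_pol p = unghost p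
    (\<lambda>m. ghost p (\<lambda>i. pvar (Inl i)) m * ghost p (\<lambda>i. pvar (Inr i)) m)"

definition witt_uminus_pol :: "nat \<Rightarrow> nat \<Rightarrow> (nat, int) pol"
  where "witt_uminus_pol p = unghost p (\<lambda>m. - ghost p pvar m)"

definition witt_add :: "nat \<Rightarrow> (nat \<Rightarrow> 'a::comm_ring_1) \<Rightarrow> (nat \<Rightarrow> 'a) \<Rightarrow> nat \<Rightarrow> 'a"
  where "witt_add p x y m = pol_eval (case_sum x y) (witt_add_pol p m)"

definition witt_mult :: "nat \<Rightarrow> (nat \<Rightarrow> 'a::comm_ring_1) \<Rightarrow> (nat \<Rightarrow> 'a) \<Rightarrow> nat \<Rightarrow> 'a"
  where "witt_mult p x y m = pol_eval (case_sum x y) (witt_mult_pol p m)"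

definition witt_uminus :: "nat \<Rightarrow> (nat \<Rightarrow> 'a::comm_ring_1) \<Rightarrow> nat \<Rightarrow> 'a"
  where "witt_uminus p x m = pol_eval x (witt_uminus_pol p m)"

lemma dvd_power_p_diff:
  fixes a b :: "'a::comm_ring_1"
  assumes "j > 0" "of_nat p ^ j dvd a - b"
  shows "of_nat p ^ Suc j dvd a ^ p - b ^ p"
proof -
  have pd: "of_nat p dvd a - b"
    using assms dvd_trans[of "of_nat p" "of_nat p ^ j"] dvd_power[of j "of_nat p"] by auto
  have pw: "of_nat p dvd a ^ i - b ^ i" for i
    unfolding power_diff_sumr2[of a i b] by (rule dvd_mult2[OF pd])
  have "of_nat p dvd (\<Sum>i<p. b ^ (p - Suc i) * a ^ i) - (\<Sum>i<p. b ^ (p - Suc i) * b ^ i)"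
    unfolding sum_subtractf[symmetric] right_diff_distrib[symmetric]
    by (intro dvd_sum dvd_mult pw)
  also have "(\<Sum>i<p. b ^ (p - Suc i) * b ^ i) = of_nat p * b ^ (p - 1)"
    by (simp add: power_add[symmetric])
  finally have "of_nat p dvd (\<Sum>i<p. b ^ (p - Suc i) * a ^ i)"
    using dvd_add[of "of_nat p" _ "of_nat p * b ^ (p - 1)"] by fastforce
  then have "of_nat p ^ j * of_nat p dvd (a - b) * (\<Sum>i<p. b ^ (p - Suc i) * a ^ i)"
    by (intro mult_dvd_mono assms)
  then show ?thesis by (simp add: power_diff_sumr2 mult.commute)
qed

lemma dvd_power_ppow_diff:
  fixes a b :: "'a::comm_ring_1"
  assumes "of_nat p dvd a - b"
  shows "of_nat p ^ Suc k dvd a ^ (p ^ k) - b ^ (p ^ k)"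
proof (induction k)
  case (Suc k)
  then have "of_nat p ^ Suc (Suc k) dvd (a ^ (p ^ k)) ^ p - (b ^ (p ^ k)) ^ p"
    by (intro dvd_power_p_diff) auto
  then show ?case by (simp add: power_mult[symmetric] mult.commute)
qed (use assms in simp)

lemma lookup_of_nat_mult: "Poly_Mapping.lookup (of_nat c * P) m = int c * Poly_Mapping.lookup P m"
  for P :: "('v, int) pol"
  by (induction c) (simp_all add: distrib_right lookup_add)

lemma pol_div_mult_cancel:
  fixes P :: "('v, int) pol"
  assumes "c > 0"
  shows "pol_div (int c) (of_nat c * P) = P"
  by (rule poly_mapping_eqI) (use assms in \<open>simp add: pol_div_def Poly_Mapping.map.rep_eq lookup_of_nat_mult when_def\<close>)

lemma pol_torsion_free:
  fixes P :: "('v, int) pol"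
  assumes "of_nat c * P = of_nat c * Q" "c > 0"
  shows "P = Q"
  by (metis assms pol_div_mult_cancel)

text \<open>The lift of Frobenius.\<close>

definition frob :: "nat \<Rightarrow> ('v, int) pol \<Rightarrow> ('v, int) pol"
  where "frob p = pol_eval (\<lambda>v. pvar v ^ p)"

lemma int_fermat: "prime p \<Longrightarrow> int p dvd c ^ p - c" for c :: int
proof -
  assume p: "prime p"
  have nat: "int p dvd int k ^ p - int k" for k
  proof (induction k)
    case 0
    then show ?case using prime_gt_0_nat[OF p] by (simp add: power_0_left)
  next
    case (Suc k)
    have "int (Suc k) ^ p = (\<Sum>i\<le>p. int (p choose i) * int k ^ i)"
      using binomial_ring[of "int k" 1 p] by (simp add: add.commute)
    also have "{..p} = insert 0 (insert p {1..<p})" using prime_gt_0_nat[OF p] by auto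
    also have "(\<Sum>i\<in>\<dots>. int (p choose i) * int k ^ i)
        = 1 + int k ^ p + (\<Sum>i\<in>{1..<p}. int (p choose i) * int k ^ i)"
      using prime_gt_0_nat[OF p] by simp
    finally have "int (Suc k) ^ p - int (Suc k)
        = (int k ^ p - int k) + (\<Sum>i\<in>{1..<p}. int (p choose i) * int k ^ i)" by simp
    moreover have "int p dvd (\<Sum>i\<in>{1..<p}. int (p choose i) * int k ^ i)"
      by (intro dvd_sum dvd_mult2) (use dvd_choose_prime p in auto)
    ultimately show ?case using Suc by (metis dvd_add)
  qed
  show "int p dvd c ^ p - c"
  proof (cases "c \<ge> 0")
    case True
    then show ?thesis using nat[of "nat c"] by simp
  next
    case False
    then have *: "int p dvd (- c) ^ p - (- c)" using nat[of "nat (- c)"] by simp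
    show ?thesis
    proof (cases "even p")
      case True
      then have "p = 2" using p primes_dvd_imp_eq two_is_prime_nat by blast
      then show ?thesis by (auto simp: power2_eq_square)
    next
      case False
      then have "(- c) ^ p - (- c) = - (c ^ p - c)" by simp
      then show ?thesis using * by (simp only: dvd_minus_iff)
    qed
  qed
qed

lemma freshman_dvd:
  fixes a b :: "'a::comm_ring_1"
  assumes p: "prime p"
  shows "of_nat p dvd (a + b) ^ p - (a ^ p + b ^ p)"
proof -
  have "(a + b) ^ p = (\<Sum>i\<le>p. of_nat (p choose i) * a ^ i * b ^ (p - i))"
    by (rule binomial_ring)
  also have "{..p} = insert 0 (insert p {1..<p})" using prime_gt_0_nat[OF p] by auto
  also have "(\<Sum>i\<in>\<dots>. of_nat (p choose i) * a ^ i * b ^ (p - i))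
      = b ^ p + a ^ p + (\<Sum>i\<in>{1..<p}. of_nat (p choose i) * a ^ i * b ^ (p - i))"
    using prime_gt_0_nat[OF p] by simp
  finally have "(a + b) ^ p - (a ^ p + b ^ p)
      = (\<Sum>i\<in>{1..<p}. of_nat (p choose i) * a ^ i * b ^ (p - i))" by simp
  also have "of_nat p dvd \<dots>"
  proof (intro dvd_sum dvd_mult2)
    fix i assume "i \<in> {1..<p}"
    then have "p dvd (p choose i)" using dvd_choose_prime[of i p] p by auto
    then show "(of_nat p :: 'a) dvd of_nat (p choose i)" by (metis dvd_def of_nat_mult)
  qed
  finally show ?thesis .
qed

lemma frob_cong: "prime p \<Longrightarrow> of_nat p dvd frob p P - P ^ p"
proof (induction P rule: pol_induct)
  case (single m c)
  have s1: "Poly_Mapping.single m c = of_int c * mon_eval pvar m" for m :: "'a \<Rightarrow>\<^sub>0 nat" and c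
  proof -
    have sv: "pvar v ^ k = Poly_Mapping.single (Poly_Mapping.single v k) 1" for v :: 'a and k
      by (induction k) (simp_all add: pvar_def mult_single single_add[symmetric] add.commute)
    have pr: "(\<Prod>v\<in>S. Poly_Mapping.single (f v) (1::int)) = Poly_Mapping.single (\<Sum>v\<in>S. f v) 1"
      for S and f :: "'a \<Rightarrow> ('a \<Rightarrow>\<^sub>0 nat)"
      by (induction S rule: infinite_finite_induct) (simp_all add: mult_single)
    have "mon_eval pvar m = Poly_Mapping.single m 1"
      unfolding mon_eval_def sv pr by (subst (3) poly_mapping_sum_singles[of m]) simp
    then show ?thesis by (simp add: mult_single single_of_int[symmetric] del: single_of_int)
  qed
  have m: "mon_eval (\<lambda>v. pvar v ^ p) m = mon_eval pvar m ^ p"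
    by (simp add: mon_eval_def prod_power_distrib power_mult[symmetric] mult.commute)
  have "frob p (Poly_Mapping.single m c) - Poly_Mapping.single m c ^ p
      = - (of_int (c ^ p - c) * mon_eval pvar m ^ p)"
    unfolding frob_def pol_eval_single m unfolding s1 by (simp add: algebra_simps)
  moreover have "(of_nat p :: ('a, int) pol) dvd of_int (c ^ p - c)"
    using int_fermat[OF single, of c] by (metis dvd_def of_int_mult of_int_of_nat_eq)
  ultimately show ?case by (metis dvd_minus_iff dvd_mult2)
next
  case (add f g)
  have "frob p (f + g) - (f + g) ^ p
     = (frob p f - f ^ p) + (frob p g - g ^ p) - ((f + g) ^ p - (f ^ p + g ^ p))"
    by (simp add: frob_def pol_eval_add)
  then show ?case
    using add freshman_dvd[OF add(3), of f g] by (metis dvd_add dvd_diff)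
qed

definition dwork :: "nat \<Rightarrow> (nat \<Rightarrow> ('v, int) pol) \<Rightarrow> bool"
  where "dwork p g \<longleftrightarrow> (\<forall>m. of_nat p ^ Suc m dvd g (Suc m) - frob p (g m))"

lemma ghost_hom: "pol_eval h (ghost p x m) = ghost p (\<lambda>i. pol_eval h (x i)) m"
  by (simp add: ghost_def pol_eval_hom)

lemma dwork_ghost_pvar: "dwork p (ghost p (\<lambda>i. pvar (f i)))"
  unfolding dwork_def
proof
  fix m
  have "frob p (ghost p (\<lambda>i. pvar (f i)) m)
      = (\<Sum>i\<le>m. of_nat p ^ i * pvar (f i) ^ (p ^ (Suc m - i)))"
    unfolding frob_def ghost_hom pol_eval_pvar unfolding ghost_def
    by (intro sum.cong) (simp_all add: Suc_diff_le power_mult)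
  then show "of_nat p ^ Suc m dvd
      ghost p (\<lambda>i. pvar (f i)) (Suc m) - frob p (ghost p (\<lambda>i. pvar (f i)) m)"
    by (simp add: ghost_def)
qed

lemma dwork_add: "dwork p g \<Longrightarrow> dwork p h \<Longrightarrow> dwork p (\<lambda>m. g m + h m)"
proof -
  have "(g (Suc m) + h (Suc m)) - frob p (g m + h m)
      = (g (Suc m) - frob p (g m)) + (h (Suc m) - frob p (h m))" for m
    by (simp add: frob_def pol_eval_add)
  then show "dwork p g \<Longrightarrow> dwork p h \<Longrightarrow> ?thesis"
    unfolding dwork_def by (metis dvd_add)
qed

lemma dwork_mult: "dwork p g \<Longrightarrow> dwork p h \<Longrightarrow> dwork p (\<lambda>m. g m * h m)"
proof -
  have "(g (Suc m) * h (Suc m)) - frob p (g m * h m)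
      = (g (Suc m) - frob p (g m)) * h (Suc m) + frob p (g m) * (h (Suc m) - frob p (h m))" for m
    by (simp add: frob_def pol_eval_mult algebra_simps)
  then show "dwork p g \<Longrightarrow> dwork p h \<Longrightarrow> ?thesis"
    unfolding dwork_def by (metis dvd_add dvd_mult dvd_mult2)
qed

lemma dwork_uminus: "dwork p g \<Longrightarrow> dwork p (\<lambda>m. - g m)"
proof -
  have "- g (Suc m) - frob p (- g m) = - (g (Suc m) - frob p (g m))" for m
    by (simp add: frob_def pol_eval_uminus)
  then show "dwork p g \<Longrightarrow> ?thesis"
    unfolding dwork_def by (metis dvd_minus_iff)
qed

lemma ghost_unghost:
  assumes p: "prime p" and g: "dwork p g"
  shows "ghost p (unghost p g) m = g m"
proof (induction m rule: less_induct)
  case (less m)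
  let ?u = "unghost p g"
  let ?s = "\<Sum>i<m. of_nat p ^ i * ?u i ^ (p ^ (m - i))"
  have "of_nat p ^ m dvd g m - ?s"
  proof (cases m)
    case 0
    then show ?thesis by simp
  next
    case (Suc k)
    have t: "of_nat p ^ m dvd frob p (of_nat p ^ i * ?u i ^ (p ^ (k - i))) - of_nat p ^ i * ?u i ^ (p ^ (m - i))"
      if "i \<le> k" for i
    proof -
      have "of_nat p ^ Suc (k - i) dvd frob p (?u i) ^ (p ^ (k - i)) - (?u i ^ p) ^ (p ^ (k - i))"
        by (rule dvd_power_ppow_diff) (rule frob_cong[OF p])
      then have "of_nat p ^ i * of_nat p ^ Suc (k - i) dvd
          of_nat p ^ i * (frob p (?u i) ^ (p ^ (k - i)) - (?u i ^ p) ^ (p ^ (k - i)))"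
        by (rule mult_dvd_mono[OF dvd_refl])
      moreover have "(of_nat p :: ('a, int) pol) ^ i * of_nat p ^ Suc (k - i) = of_nat p ^ m"
        using that Suc by (metis Suc_diff_le le_Suc_eq le_add_diff_inverse power_add)
      moreover have "(?u i ^ p) ^ (p ^ (k - i)) = ?u i ^ (p ^ (m - i))"
        using that Suc by (simp add: Suc_diff_le power_mult)
      ultimately show ?thesis
        by (simp add: frob_def pol_eval_hom right_diff_distrib)
    qed
    have "frob p (g k) = frob p (ghost p ?u k)" using less[of k] Suc by simp
    also have "\<dots> = (\<Sum>i\<le>k. frob p (of_nat p ^ i * ?u i ^ (p ^ (k - i))))"
      by (simp add: ghost_def frob_def pol_eval_sum)
    finally have "frob p (g k) - ?s = (\<Sum>i\<le>k. frob p (of_nat p ^ i * ?u i ^ (p ^ (k - i)))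
        - of_nat p ^ i * ?u i ^ (p ^ (m - i)))"
      using Suc by (simp add: sum_subtractf lessThan_Suc_atMost)
    moreover have "of_nat p ^ m dvd \<dots>" by (intro dvd_sum t) simp
    ultimately have "of_nat p ^ m dvd frob p (g k) - ?s" by simp
    moreover have "of_nat p ^ m dvd g m - frob p (g k)" using g Suc by (auto simp: dwork_def)
    ultimately have "of_nat p ^ m dvd (g m - frob p (g k)) + (frob p (g k) - ?s)" by (rule dvd_add[rotated])
    then show ?thesis by simp
  qed
  then obtain q where q: "g m - ?s = of_nat (p ^ m) * q" by (auto elim: dvdE)
  have "?u m = pol_div (int (p ^ m)) (of_nat (p ^ m) * q)"
    by (subst unghost.simps) (use q in simp)
  also have "\<dots> = q" by (rule pol_div_mult_cancel) (use prime_gt_0_nat[OF p] in simp)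
  finally have "of_nat p ^ m * ?u m = g m - ?s" using q by simp
  then show ?case by (simp add: ghost_def lessThan_Suc_atMost[symmetric])
qed

lemma ghost_witt_add: "prime p \<Longrightarrow> ghost p (witt_add p x y) m = ghost p x m + ghost p y m"
  and ghost_witt_mult: "prime p \<Longrightarrow> ghost p (witt_mult p x y) m = ghost p x m * ghost p y m"
  and ghost_witt_uminus: "prime p \<Longrightarrow> ghost p (witt_uminus p x) m = - ghost p x m"
proof -
  assume p: "prime p"
  show "ghost p (witt_add p x y) m = ghost p x m + ghost p y m"
    unfolding witt_add_def witt_add_pol_def ghost_hom[symmetric]
    by (subst ghost_unghost[OF p]) (simp_all add: dwork_add dwork_ghost_pvar pol_eval_add ghost_hom)
  show "ghost p (witt_mult p x y) m = ghost p x m * ghost p y m"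
    unfolding witt_mult_def witt_mult_pol_def ghost_hom[symmetric]
    by (subst ghost_unghost[OF p]) (simp_all add: dwork_mult dwork_ghost_pvar pol_eval_mult ghost_hom)
  show "ghost p (witt_uminus p x) m = - ghost p x m"
    unfolding witt_uminus_def witt_uminus_pol_def ghost_hom[symmetric]
    by (subst ghost_unghost[OF p])
      (use dwork_ghost_pvar[of p id] in \<open>simp_all add: dwork_uminus pol_eval_uminus ghost_hom\<close>)
qed

lemma ghost_inj:
  fixes x y :: "nat \<Rightarrow> ('v, int) pol"
  assumes p: "prime p" and eq: "\<And>m. m < N \<Longrightarrow> ghost p x m = ghost p y m"
  shows "m < N \<Longrightarrow> x m = y m"
proof (induction m rule: less_induct)
  case (less m)
  have "(\<Sum>i<m. of_nat p ^ i * x i ^ (p ^ (m - i))) = (\<Sum>i<m. of_nat p ^ i * y i ^ (p ^ (m - i)))"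
    using less by (intro sum.cong) auto
  then have "of_nat (p ^ m) * x m = of_nat (p ^ m) * y m"
    using eq[OF less(2)] by (simp add: ghost_def lessThan_Suc_atMost[symmetric])
  then show ?case by (rule pol_torsion_free) (use prime_gt_0_nat[OF p] in simp)
qed

lemma ghost_inj_all:
  fixes x y :: "nat \<Rightarrow> ('v, int) pol"
  assumes "prime p" "\<And>m. ghost p x m = ghost p y m"
  shows "x = y"
  by (rule ext) (use ghost_inj[of p "Suc _" x y] assms in blast)

lemma ghost_cong: "(\<And>i. i \<le> m \<Longrightarrow> x i = y i) \<Longrightarrow> ghost p x m = ghost p y m"
  unfolding ghost_def by (intro sum.cong) auto

lemma pol_eval_witt_add:
    "pol_eval h (witt_add p x y m) = witt_add p (\<lambda>i. pol_eval h (x i)) (\<lambda>i. pol_eval h (y i)) m"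
  and pol_eval_witt_mult:
    "pol_eval h (witt_mult p x y m) = witt_mult p (\<lambda>i. pol_eval h (x i)) (\<lambda>i. pol_eval h (y i)) m"
  and pol_eval_witt_uminus:
    "pol_eval h (witt_uminus p x m) = witt_uminus p (\<lambda>i. pol_eval h (x i)) m"
proof -
  have "(\<lambda>v. pol_eval h (case_sum x y v)) = case_sum (\<lambda>i. pol_eval h (x i)) (\<lambda>i. pol_eval h (y i))"
    by (auto split: sum.split)
  then show
    "pol_eval h (witt_add p x y m) = witt_add p (\<lambda>i. pol_eval h (x i)) (\<lambda>i. pol_eval h (y i)) m"
    "pol_eval h (witt_mult p x y m) = witt_mult p (\<lambda>i. pol_eval h (x i)) (\<lambda>i. pol_eval h (y i)) m"
    "pol_eval h (witt_uminus p x m) = witt_uminus p (\<lambda>i. pol_eval h (x i)) m"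
    by (simp_all add: witt_add_def witt_mult_def witt_uminus_def pol_eval_pol_eval)
qed

lemma witt_ops_cong:
  fixes x y x' y' :: "nat \<Rightarrow> 'a::comm_ring_1"
  assumes p: "prime p" and m: "m < N"
    and x: "\<And>i. i < N \<Longrightarrow> x i = x' i" and y: "\<And>i. i < N \<Longrightarrow> y i = y' i"
  shows "witt_add p x y m = witt_add p x' y' m"
    and "witt_mult p x y m = witt_mult p x' y' m"
    and "witt_uminus p x m = witt_uminus p x' m"
proof -
  have gx: "ghost p (\<lambda>i. pvar (x i)) k = ghost p (\<lambda>i. pvar (x' i)) k"
    and gy: "ghost p (\<lambda>i. pvar (y i)) k = ghost p (\<lambda>i. pvar (y' i)) k" if "k < N" for k
    using that x y by (auto intro!: ghost_cong)
  have "witt_add p (\<lambda>i. pvar (x i)) (\<lambda>i. pvar (y i)) m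
      = witt_add p (\<lambda>i. pvar (x' i)) (\<lambda>i. pvar (y' i)) m"
    by (rule ghost_inj[OF p _ m]) (simp add: ghost_witt_add p gx gy)
  then show "witt_add p x y m = witt_add p x' y' m"
    by (drule_tac arg_cong[of _ _ "pol_eval (\<lambda>a. a)"]) (simp add: pol_eval_witt_add)
  have "witt_mult p (\<lambda>i. pvar (x i)) (\<lambda>i. pvar (y i)) m
      = witt_mult p (\<lambda>i. pvar (x' i)) (\<lambda>i. pvar (y' i)) m"
    by (rule ghost_inj[OF p _ m]) (simp add: ghost_witt_mult p gx gy)
  then show "witt_mult p x y m = witt_mult p x' y' m"
    by (drule_tac arg_cong[of _ _ "pol_eval (\<lambda>a. a)"]) (simp add: pol_eval_witt_mult)
  have "witt_uminus p (\<lambda>i. pvar (x i)) m = witt_uminus p (\<lambda>i. pvar (x' i)) m"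
    by (rule ghost_inj[OF p _ m]) (simp add: ghost_witt_uminus p gx)
  then show "witt_uminus p x m = witt_uminus p x' m"
    by (drule_tac arg_cong[of _ _ "pol_eval (\<lambda>a. a)"]) (simp add: pol_eval_witt_uminus)
qed


section \<open>Truncated Witt vectors\<close>

text \<open>\<open>('a, 'n) witt\<close> is the ring of \<open>p\<close>-typical Witt vectors of length \<open>CARD('n)\<close> over \<open>'a\<close>, where \<open>p\<close> is
  the characteristic of \<open>'a\<close>; so the ring of vectors of length \<open>n + 1\<close> corresponds to
  \<open>CARD('n) = n + 1\<close>. Components are numbered from \<open>0\<close>.\<close>

typedef (overloaded) ('a::zero, 'n::finite) witt = "{x :: nat \<Rightarrow> 'a. \<forall>i\<ge>CARD('n). x i = 0}"
  morphisms witt_nth Abs_witt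
  by (rule exI[of _ "\<lambda>_. 0"]) simp

definition to_witt :: "(nat \<Rightarrow> 'a) \<Rightarrow> ('a::zero, 'n::finite) witt"
  where "to_witt x = Abs_witt (\<lambda>i. if i < CARD('n) then x i else 0)"

lemma witt_nth_to_witt:
  "witt_nth (to_witt x :: ('a::zero, 'n::finite) witt) i = (if i < CARD('n) then x i else 0)"
  unfolding to_witt_def by (subst Abs_witt_inverse) auto

lemma to_witt_nth [simp]: "to_witt (witt_nth x) = (x :: ('a::zero, 'n::finite) witt)"
proof -
  have "(\<lambda>i. if i < CARD('n) then witt_nth x i else 0) = witt_nth x"
    using witt_nth[of x] by fastforce
  then show ?thesis by (simp add: to_witt_def witt_nth_inverse)
qed

lemma to_witt_cong:
  "(\<And>i. i < CARD('n) \<Longrightarrow> x i = y i) \<Longrightarrow> (to_witt x :: ('a::zero, 'n::finite) witt) = to_witt y"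
  unfolding to_witt_def by (rule arg_cong[of _ _ Abs_witt]) auto

instantiation witt :: (comm_ring_prime_char, finite) comm_ring_1
begin

definition "0 = (to_witt (\<lambda>_. 0) :: ('a, 'b) witt)"
definition "1 = (to_witt (\<lambda>i. if i = 0 then 1 else 0) :: ('a, 'b) witt)"
definition "x + y = (to_witt (witt_add CHAR('a) (witt_nth x) (witt_nth y)) :: ('a, 'b) witt)"
definition "x * y = (to_witt (witt_mult CHAR('a) (witt_nth x) (witt_nth y)) :: ('a, 'b) witt)"
definition "- x = (to_witt (witt_uminus CHAR('a) (witt_nth x)) :: ('a, 'b) witt)"
definition "x - y = x + (- y :: ('a, 'b) witt)"

instance
proof -
  let ?p = "CHAR('a)"
  have p: "prime ?p" by simp
  define \<pi> :: "(nat \<Rightarrow> ('a, int) pol) \<Rightarrow> ('a, 'b) witt"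
    where "\<pi> X = to_witt (\<lambda>i. pol_eval (\<lambda>a. a) (X i))" for X
  have surj: "\<exists>X. x = \<pi> X" for x
    by (rule exI[of _ "\<lambda>i. pvar (witt_nth x i)"]) (simp add: \<pi>_def)
  have add: "\<pi> X + \<pi> Y = \<pi> (witt_add ?p X Y)"
    and mult: "\<pi> X * \<pi> Y = \<pi> (witt_mult ?p X Y)"
    and um: "- \<pi> X = \<pi> (witt_uminus ?p X)" for X Y
    unfolding plus_witt_def times_witt_def uminus_witt_def \<pi>_def
      pol_eval_witt_add pol_eval_witt_mult pol_eval_witt_uminus
    by (rule to_witt_cong, rule witt_ops_cong[OF p, of _ "CARD('b)"];
        simp add: witt_nth_to_witt)+
  have zero: "0 = \<pi> (\<lambda>_. 0)" by (simp add: zero_witt_def \<pi>_def)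
  have one: "1 = \<pi> (\<lambda>i. if i = 0 then 1 else 0)"
    unfolding one_witt_def \<pi>_def by (rule to_witt_cong) simp
  have g0: "ghost ?p (\<lambda>_. 0 :: ('a, int) pol) m = 0" for m
    using prime_gt_0_nat[OF p] by (simp add: ghost_def power_0_left)
  have g1: "ghost ?p (\<lambda>i. if i = 0 then 1 else 0 :: ('a, int) pol) m = 1" for m
  proof -
    have "ghost ?p (\<lambda>i. if i = 0 then 1 else 0 :: ('a, int) pol) m
        = (\<Sum>i\<le>m. if i = 0 then 1 else 0)"
      unfolding ghost_def using prime_gt_0_nat[OF p] by (intro sum.cong) (auto simp: power_0_left)
    then show ?thesis by simp
  qed
  note g = ghost_witt_add[OF p] ghost_witt_mult[OF p] ghost_witt_uminus[OF p] g0 g1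
  note w = add mult um zero one
  note eq = arg_cong[of _ _ \<pi>, OF ghost_inj_all[OF p]]
  show "OFCLASS(('a, 'b) witt, comm_ring_1_class)"
  proof
    fix x y z :: "('a, 'b) witt"
    obtain X Y Z where *: "x = \<pi> X" "y = \<pi> Y" "z = \<pi> Z" using surj by metis
    show "x + y + z = x + (y + z)" unfolding * w by (rule eq) (simp add: g algebra_simps)
    show "x + y = y + x" unfolding * w by (rule eq) (simp add: g algebra_simps)
    show "0 + x = x" unfolding * w by (rule eq) (simp add: g)
    show "- x + x = 0" unfolding * w by (rule eq) (simp add: g)
    show "x - y = x + - y" by (simp add: minus_witt_def)
    show "x * y * z = x * (y * z)" unfolding * w by (rule eq) (simp add: g algebra_simps)
    show "x * y = y * x" unfolding * w by (rule eq) (simp add: g algebra_simps)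
    show "1 * x = x" unfolding * w by (rule eq) (simp add: g)
    show "(x + y) * z = x * z + y * z" unfolding * w by (rule eq) (simp add: g algebra_simps)
    have "witt_nth (0 :: ('a, 'b) witt) 0 \<noteq> witt_nth 1 0"
      by (simp add: zero_witt_def one_witt_def witt_nth_to_witt)
    then show "(0 :: ('a, 'b) witt) \<noteq> 1" by metis
  qed
qed

end

definition witt_map :: "('a \<Rightarrow> 'b) \<Rightarrow> ('a::zero, 'n::finite) witt \<Rightarrow> ('b::zero, 'n) witt"
  where "witt_map f x = to_witt (\<lambda>i. f (witt_nth x i))"

lemma CHAR_poly_mapping: "CHAR('b::comm_monoid_add \<Rightarrow>\<^sub>0 'a::comm_semiring_1) = CHAR('a)"
proof (rule CHAR_eqI)
  show "of_nat CHAR('a) = (0 :: 'b \<Rightarrow>\<^sub>0 'a)"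
    by (simp add: single_of_nat[symmetric] del: single_of_nat)
next
  fix n assume "of_nat n = (0 :: 'b \<Rightarrow>\<^sub>0 'a)"
  then have "Poly_Mapping.lookup (of_nat n :: 'b \<Rightarrow>\<^sub>0 'a) 0 = 0" by simp
  then show "CHAR('a) dvd n" by (simp add: lookup_of_nat of_nat_eq_0_iff_char_dvd)
qed

instance poly_mapping :: (comm_monoid_add, comm_ring_prime_char) comm_ring_prime_char
proof
  have "of_nat CHAR('b) = (0 :: 'a \<Rightarrow>\<^sub>0 'b)"
    using CHAR_poly_mapping[where 'b = 'a and 'a = 'b] of_nat_CHAR by metis
  then show "\<exists>n. prime n \<and> of_nat n = (0 :: 'a \<Rightarrow>\<^sub>0 'b)"
    using CHAR_prime by blast
qed


section \<open>Grothendieck differential operators\<close>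

text \<open>The ring \<open>'a\<close> is an algebra over \<open>'c\<close> via the structure homomorphism \<open>\<rho>\<close>.\<close>

definition alg_linear :: "('c::comm_ring_1 \<Rightarrow> 'a::comm_ring_1) \<Rightarrow> ('a \<Rightarrow> 'a) \<Rightarrow> bool"
  where "alg_linear \<rho> \<delta> \<longleftrightarrow>
    (\<forall>x y. \<delta> (x + y) = \<delta> x + \<delta> y) \<and> (\<forall>c x. \<delta> (\<rho> c * x) = \<rho> c * \<delta> x)"

primrec diff_ops_le :: "('c::comm_ring_1 \<Rightarrow> 'a::comm_ring_1) \<Rightarrow> nat \<Rightarrow> ('a \<Rightarrow> 'a) set" where
  "diff_ops_le \<rho> 0 = {\<delta>. alg_linear \<rho> \<delta> \<and> (\<forall>a x. \<delta> (a * x) = a * \<delta> x)}"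
| "diff_ops_le \<rho> (Suc m) =
    {\<delta>. alg_linear \<rho> \<delta> \<and> (\<forall>a. (\<lambda>x. \<delta> (a * x) - a * \<delta> x) \<in> diff_ops_le \<rho> m)}"

definition diff_ops :: "('c::comm_ring_1 \<Rightarrow> 'a::comm_ring_1) \<Rightarrow> ('a \<Rightarrow> 'a) set"
  where "diff_ops \<rho> = (\<Union>m. diff_ops_le \<rho> m)"


section \<open>Operators on the polynomial rings and on the Witt vectors\<close>

text \<open>With \<open>'k\<close> the base field, \<open>A\<close> is \<open>('d, 'k) pol\<close>, \<open>A\<^sub>n\<^sub>+\<^sub>1\<close> is
  \<open>('d, ('k, 'n) witt) pol\<close> and the Witt vectors of length \<open>n + 1\<close> over \<open>A\<close> are
  \<open>(('d, 'k) pol, 'n) witt\<close>, where \<open>CARD('n) = n + 1\<close> and \<open>CARD('d) = d\<close>. The order on \<open>'d\<close> only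
  fixes the order \<open>t\<^sub>1, \<dots>, t\<^sub>d\<close> of the variables.\<close>

definition const_pol :: "'a::zero \<Rightarrow> ('d, 'a) pol"
  where "const_pol c = Poly_Mapping.single 0 c"

definition pol_diff_ops :: "(('d, 'a::comm_ring_1) pol \<Rightarrow> ('d, 'a) pol) set"
  where "pol_diff_ops = diff_ops const_pol"

definition witt_diff_ops ::
    "((('d, 'k::comm_ring_prime_char) pol, 'n::finite) witt \<Rightarrow> (('d, 'k) pol, 'n) witt) set"
  where "witt_diff_ops = diff_ops (witt_map const_pol :: ('k, 'n) witt \<Rightarrow> _)"

definition divided_partial :: "'d \<Rightarrow> nat \<Rightarrow> ('d, 'a::comm_ring_1) pol \<Rightarrow> ('d, 'a) pol"
  where "divided_partial j r f = (\<Sum>m\<in>Poly_Mapping.keys f.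
    Poly_Mapping.single (m - Poly_Mapping.single j r)
      (of_nat (Poly_Mapping.lookup m j choose r) * Poly_Mapping.lookup f m))"

text \<open>For perfect \<open>'k\<close> the kernel of the following map is \<open>p A\<^sub>n\<^sub>+\<^sub>1\<close>, so that it is the reduction modulo \<open>p\<close>.\<close>

definition pol_red :: "('d, ('k::comm_ring_prime_char, 'n::finite) witt) pol \<Rightarrow> ('d, 'k) pol"
  where "pol_red = Poly_Mapping.map (\<lambda>c. witt_nth c 0)"

definition is_lift :: "(('d, ('k::comm_ring_prime_char, 'n::finite) witt) pol \<Rightarrow> ('d, ('k, 'n) witt) pol)
    \<Rightarrow> (('d, 'k) pol \<Rightarrow> ('d, 'k) pol) \<Rightarrow> bool"
  where "is_lift \<delta> \<theta> \<longleftrightarrow> \<delta> \<in> pol_diff_ops \<and> (\<forall>f. pol_red (\<delta> f) = \<theta> (pol_red f))"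

text \<open>The lifts of \<open>\<partial>\<^sub>j\<^sup>[\<^sup>r\<^sup>]\<close> as a divided power operator: those which belong to a Hasse-Schmidt derivation
  of length \<open>r\<close> lifting \<open>(\<partial>\<^sub>j\<^sup>[\<^sup>i\<^sup>])\<close> for \<open>i \<le> r\<close>. For arbitrary lifts (for instance \<open>id\<close> and \<open>(1 + p) id\<close> as lifts of
  \<open>\<partial>\<^sub>j\<^sup>[\<^sup>0\<^sup>] = id\<close>) the restriction to the Witt vectors does depend on the lift.\<close>

definition is_divided_lift ::
    "'d \<Rightarrow> nat \<Rightarrow> (('d, ('k::comm_ring_prime_char, 'n::finite) witt) pol \<Rightarrow> ('d, ('k, 'n) witt) pol) \<Rightarrow> bool"
  where "is_divided_lift j r \<delta> \<longleftrightarrow> (\<exists>E. E r = \<delta> \<and> E 0 = id \<and>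
    (\<forall>i\<le>r. is_lift (E i) (divided_partial j i) \<and>
      (\<forall>f g. E i (f * g) = (\<Sum>a\<le>i. E a f * E (i - a) g))))"

definition multi_op :: "('d::{finite,linorder} \<Rightarrow> nat \<Rightarrow> 'b \<Rightarrow> 'b) \<Rightarrow> ('d \<Rightarrow>\<^sub>0 nat) \<Rightarrow> 'b \<Rightarrow> 'b"
  where "multi_op D r =
    foldr (\<lambda>j g. D j (Poly_Mapping.lookup r j) \<circ> g) (sorted_list_of_set UNIV) id"

definition op_sum :: "(('d \<Rightarrow>\<^sub>0 nat) \<Rightarrow> 'b::comm_ring_1) \<Rightarrow> ('d::{finite,linorder} \<Rightarrow> nat \<Rightarrow> 'b \<Rightarrow> 'b) \<Rightarrow> 'b \<Rightarrow> 'b"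
  where "op_sum c D f = (\<Sum>r | c r \<noteq> 0. c r * multi_op D r f)"

definition ghost_map ::
    "(('d, 'k::comm_ring_prime_char) pol, 'n::finite) witt \<Rightarrow> ('d, ('k, 'n) witt) pol"
  where "ghost_map x = (\<Sum>i<CARD('n).
    of_nat CHAR('k) ^ i * (SOME f. pol_red f = witt_nth x i) ^ (CHAR('k) ^ (CARD('n) - 1 - i)))"

definition is_restriction ::
    "(('d, ('k::comm_ring_prime_char, 'n::finite) witt) pol \<Rightarrow> ('d, ('k, 'n) witt) pol)
      \<Rightarrow> ((('d, 'k) pol, 'n) witt \<Rightarrow> (('d, 'k) pol, 'n) witt) \<Rightarrow> bool"
  where "is_restriction \<delta> R \<longleftrightarrow> R \<in> witt_diff_ops \<and> (\<forall>x. ghost_map (R x) = \<delta> (ghost_map x))"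

definition multi_val :: "nat \<Rightarrow> ('d \<Rightarrow>\<^sub>0 nat) \<Rightarrow> enat"
  where "multi_val p r = (INF j\<in>Poly_Mapping.keys r. enat (multiplicity p (Poly_Mapping.lookup r j)))"

definition ppow_ideal :: "nat \<Rightarrow> enat \<Rightarrow> 'a::comm_ring_1 set"
  where "ppow_ideal p v = (case v of enat m \<Rightarrow> {a. of_nat p ^ m dvd a} | \<infinity> \<Rightarrow> {0})"

end

theory Submission
  imports Defs
begin

text \<open>Let \<open>W\<close> be the ring of Witt vectors of length \<open>n + 1\<close> over the perfect field \<open>k\<close> and \<open>v(m)\<close>
the minimum of the \<open>p\<close>-adic valuations of the nonzero entries of a multi-index \<open>m\<close>. Everything rests
on a description of the image of the ghost map: its \<open>W\<close>-span is the module \<open>B\<close> of the polynomials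
over \<open>W\<close> whose coefficient at \<open>t\<^sup>m\<close> is divisible by \<open>p\<^bsup>n-v(m)\<^esup>\<close> whenever \<open>v(m) < n\<close>. The image lies
in \<open>B\<close> (\<open>ghost_map_val_bounded\<close>), because this holds for \<open>p\<^sup>i f\<close> when \<open>f\<close> is a \<open>p\<^bsup>n-i\<^esup>\<close>-th power.
Conversely, the monomials \<open>p\<^bsup>n-e\<^esup> t\<^sup>m\<close> with \<open>e \<le> n\<close> and \<open>p\<^sup>e\<close> dividing \<open>m\<close> lie in the image and
generate \<open>B\<close> over \<open>W\<close> (\<open>ghost_map_monomial\<close>, \<open>val_bounded_monomial\<close>).

\<^bold>\<open>Existence.\<close> Every differential operator of a polynomial ring is a finite combination of the
operators \<open>\<partial>\<^sup>[\<^sup>r\<^sup>]\<close> (\<open>pol_diff_ops_eq_op_sum\<close>): an operator of order at most \<open>m\<close> is determined by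
its values on monomials of degree at most \<open>m\<close>, and these values can be prescribed by such a
combination. Lifting its coefficients lifts the operator.

\<^bold>\<open>Independence.\<close> A divided power lift is part of a Hasse-Schmidt derivation \<open>E\<close>, and \<open>f \<mapsto> \<Sum>\<^sub>i E\<^sub>i(f)
T\<^sup>i\<close> is multiplicative modulo \<open>T\<^bsup>r+1\<^esup>\<close>. Two lifts give series that are congruent modulo \<open>p\<close>, whose
\<open>p\<^sup>l\<close>-th powers are then congruent modulo \<open>p\<^bsup>l+1\<^esup>\<close>. As \<open>p\<^bsup>n+1\<^esup> = 0\<close>, both lifts agree on all \<open>p\<^sup>i
f\<^bsup>p\<^sup>n\<^sup>-\<^sup>i\<^esup>\<close> and hence, being \<open>W\<close>-linear, on \<open>B\<close> (\<open>is_divided_lift_unique\<close>). The standard operators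
map \<open>B\<close> to itself, because \<open>p\<^bsup>v(m) - v(r)\<^esup>\<close> divides the binomial coefficient of numbers \<open>m\<close> over
\<open>r > 0\<close>; so the same holds for products of lifts.

\<^bold>\<open>Vanishing.\<close> As the ghost map has trivial kernel (\<open>ghost_map_eq_0\<close>), a restriction is zero if and
only if the operator kills \<open>B\<close>. If \<open>a\<^sub>r\<close> is divisible by \<open>p\<^bsup>v(r)+1\<^esup>\<close>, then \<open>a\<^sub>r \<partial>\<^sup>[\<^sup>r\<^sup>]\<close> kills \<open>B\<close>,
again by the divisibility of binomial coefficients. Conversely, evaluating the operator at the
monomials \<open>p\<^bsup>n-v(r)\<^esup> t\<^sup>r\<close> in the order of increasing degree isolates \<open>p\<^bsup>n-v(r)\<^esup> a\<^sub>r = 0\<close>, with \<open>n\<close>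
in place of \<open>v(r)\<close> if \<open>v(r) > n\<close> (\<open>op_sum_annihilates_ghost_iff\<close>).\<close>

section \<open>Multiplication by \<open>p\<close> on truncated Witt vectors\<close>

lemma dvd_of_nat_mult_cancel:
  fixes P Q :: "('v, int) pol"
  assumes "of_nat c * P dvd of_nat c * Q" "c > 0"
  shows "P dvd Q"
proof -
  obtain K where "of_nat c * Q = of_nat c * P * K" using assms(1) by (auto elim: dvdE)
  then have "of_nat c * Q = of_nat c * (P * K)" by (simp add: mult.assoc)
  then show ?thesis using pol_torsion_free[OF _ assms(2)] by (metis dvd_triv_left)
qed

text \<open>A converse of the congruence that underlies the ghost components: sequences of integer
polynomials whose ghost components agree modulo \<open>p\<^bsup>m+1\<^esup>\<close> for all \<open>m\<close> agree modulo \<open>p\<close>.\<close>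
lemma ghost_cong_imp_cong:
  fixes x y :: "nat \<Rightarrow> ('v, int) pol"
  assumes p: "prime p"
    and eq: "\<And>m. of_nat p ^ Suc m dvd ghost p x m - ghost p y m"
  shows "of_nat p dvd x m - y m"
proof (induction m rule: less_induct)
  case (less m)
  have t: "of_nat p ^ Suc m dvd of_nat p ^ i * x i ^ (p ^ (m - i)) - of_nat p ^ i * y i ^ (p ^ (m - i))"
    if "i < m" for i
  proof -
    have "of_nat p ^ i * of_nat p ^ Suc (m - i) dvd
        of_nat p ^ i * (x i ^ (p ^ (m - i)) - y i ^ (p ^ (m - i)))"
      by (intro mult_dvd_mono dvd_refl dvd_power_ppow_diff less that)
    moreover have "(of_nat p :: ('v, int) pol) ^ i * of_nat p ^ Suc (m - i) = of_nat p ^ Suc m"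
      using that by (simp flip: power_add power_Suc)
    ultimately show ?thesis by (simp only: right_diff_distrib)
  qed
  have g: "ghost p z m = (\<Sum>i<m. of_nat p ^ i * z i ^ (p ^ (m - i))) + of_nat p ^ m * z m"
    for z :: "nat \<Rightarrow> ('v, int) pol"
    by (simp add: ghost_def lessThan_Suc_atMost[symmetric])
  have "of_nat p ^ Suc m
      dvd (\<Sum>i<m. of_nat p ^ i * x i ^ (p ^ (m - i)) - of_nat p ^ i * y i ^ (p ^ (m - i)))"
    by (intro dvd_sum t) simp
  from dvd_diff[OF eq[of m] this]
  have "of_nat p ^ Suc m dvd of_nat p ^ m * x m - of_nat p ^ m * y m"
    by (simp add: g sum_subtractf)
  then have "of_nat (p ^ m) * of_nat p dvd of_nat (p ^ m) * (x m - y m)"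
    by (simp add: right_diff_distrib mult.commute)
  then show ?case by (rule dvd_of_nat_mult_cancel) (use prime_gt_0_nat[OF p] in simp)
qed

text \<open>The Witt vector represented by a sequence of integer polynomials in variables indexed by the
elements of the ring, each variable being evaluated at its index. Every Witt vector arises in this
way, and identities between such sequences can be checked on ghost components, over a ring without
torsion.\<close>
definition lift_witt :: "(nat \<Rightarrow> ('a::comm_ring_prime_char, int) pol) \<Rightarrow> ('a, 'n::finite) witt"
  where "lift_witt X = to_witt (\<lambda>i. pol_eval (\<lambda>a. a) (X i))"

lemma lift_witt_add:
  "lift_witt X + lift_witt Y
      = (lift_witt (witt_add CHAR('a) X Y) :: ('a::comm_ring_prime_char, 'n::finite) witt)"
  unfolding plus_witt_def lift_witt_def pol_eval_witt_add
  by (rule to_witt_cong, rule witt_ops_cong(1)[of _ _ "CARD('n)"]) (simp_all add: witt_nth_to_witt)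

lemma of_nat_mult_lift_witt:
  "\<exists>Z. of_nat j * (lift_witt X :: ('a::comm_ring_prime_char, 'n::finite) witt) = lift_witt Z
     \<and> (\<forall>m. ghost CHAR('a) Z m = of_nat j * ghost CHAR('a) X m)"
proof (induction j)
  case 0
  have "0 = (lift_witt (\<lambda>_. 0) :: ('a, 'n) witt)" by (simp add: lift_witt_def zero_witt_def)
  moreover have "ghost CHAR('a) (\<lambda>_. 0 :: ('a, int) pol) m = 0" for m
    using prime_gt_0_nat[OF CHAR_prime[where 'a='a]] by (simp add: ghost_def power_0_left)
  ultimately show ?case by auto
next
  case (Suc j)
  then obtain Z where Z: "of_nat j * (lift_witt X :: ('a, 'n) witt) = lift_witt Z"
    "\<And>m. ghost CHAR('a) Z m = of_nat j * ghost CHAR('a) X m" by auto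
  have "of_nat (Suc j) * (lift_witt X :: ('a, 'n) witt) = lift_witt (witt_add CHAR('a) X Z)"
    by (simp add: distrib_right Z(1) flip: lift_witt_add)
  moreover have "ghost CHAR('a) (witt_add CHAR('a) X Z) m = of_nat (Suc j) * ghost CHAR('a) X m" for m
    by (simp add: ghost_witt_add Z(2) distrib_right)
  ultimately show ?case by blast
qed

lemma witt_nth_ge: "i \<ge> CARD('n) \<Longrightarrow> witt_nth (x :: ('a::zero, 'n::finite) witt) i = 0"
  using witt_nth[of x] by auto

lemma witt_eqI:
  "(\<And>i. i < CARD('n) \<Longrightarrow> witt_nth x i = witt_nth y i) \<Longrightarrow> x = (y :: ('a::zero, 'n::finite) witt)"
  by (metis to_witt_cong to_witt_nth)

text \<open>Multiplication by \<open>p\<close> is the composition of Frobenius and Verschiebung: \<open>p (x\<^sub>0, x\<^sub>1, \<dots>) = (0,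
x\<^sub>0\<^sup>p, x\<^sub>1\<^sup>p, \<dots>)\<close>.\<close>
lemma witt_nth_p_mult:
  fixes x :: "('a::comm_ring_prime_char, 'n::finite) witt"
  shows "witt_nth (of_nat CHAR('a) * x) i
    = (if i = 0 \<or> i \<ge> CARD('n) then 0 else witt_nth x (i - 1) ^ CHAR('a))"
proof (cases "i < CARD('n)")
  case True
  define p where "p = CHAR('a)"
  have p: "prime p" by (simp add: p_def)
  define X :: "nat \<Rightarrow> ('a, int) pol" where "X j = pvar (witt_nth x j)" for j
  have X: "lift_witt X = x" by (simp add: lift_witt_def X_def)
  obtain Z where Z: "of_nat p * x = lift_witt Z" "\<And>m. ghost p Z m = of_nat p * ghost p X m"
    using of_nat_mult_lift_witt[of p X, where 'n='n] by (auto simp: X p_def)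
  \<comment> \<open>\<open>Y\<close> lifts the right-hand side; its \<open>m\<close>-th ghost component differs from that of \<open>p X\<close> by \<open>p\<^bsup>m+1\<^esup> X\<^sub>m\<close>.\<close>
  define Y where "Y i = (if i = 0 then 0 else X (i - 1) ^ p)" for i
  have gY: "ghost p Y m = of_nat p * ghost p X m - of_nat p ^ Suc m * X m" for m
  proof -
    have "ghost p Y m = (\<Sum>i\<in>{1..m}. of_nat p ^ i * Y i ^ (p ^ (m - i)))"
      unfolding ghost_def
      by (rule sum.mono_neutral_right) (use prime_gt_0_nat[OF p] in \<open>auto simp: Y_def power_0_left\<close>)
    also have "\<dots> = (\<Sum>i<m. of_nat p ^ Suc i * Y (Suc i) ^ (p ^ (m - Suc i)))"
      by (rule sum.reindex_bij_witness[of _ Suc "\<lambda>i. i - 1"]) auto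
    also have "\<dots> = (\<Sum>i<m. of_nat p * (of_nat p ^ i * X i ^ (p ^ (m - i))))"
    proof (rule sum.cong)
      fix i assume "i \<in> {..<m}"
      then have "p ^ (m - i) = p * p ^ (m - Suc i)" by (simp flip: power_Suc add: Suc_diff_Suc)
      then show "of_nat p ^ Suc i * Y (Suc i) ^ (p ^ (m - Suc i))
          = of_nat p * (of_nat p ^ i * X i ^ (p ^ (m - i)))"
        by (simp add: Y_def power_mult mult.assoc)
    qed simp
    finally show ?thesis
      by (simp add: ghost_def lessThan_Suc_atMost[symmetric] sum_distrib_left algebra_simps)
  qed
  have "of_nat p dvd Z i - Y i"
    by (rule ghost_cong_imp_cong[OF p]) (simp add: Z(2) gY)
  then obtain K where "Z i = Y i + of_nat p * K" by (auto elim!: dvdE simp: algebra_simps)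
  then have "pol_eval (\<lambda>a. a) (Z i) = pol_eval (\<lambda>a. a) (Y i)"
    by (simp add: pol_eval_add pol_eval_mult p_def)
  also have "\<dots> = (if i = 0 then 0 else witt_nth x (i - 1) ^ p)"
    by (simp add: Y_def X_def pol_eval_power)
  finally show ?thesis using True Z(1) by (simp add: p_def lift_witt_def witt_nth_to_witt)
qed (simp add: witt_nth_ge)

lemma witt_nth_p_power_mult:
  fixes x :: "('a::comm_ring_prime_char, 'n::finite) witt"
  shows "witt_nth (of_nat CHAR('a) ^ j * x) i
    = (if i < j \<or> i \<ge> CARD('n) then 0 else witt_nth x (i - j) ^ (CHAR('a) ^ j))"
proof (induction j arbitrary: i)
  case 0
  then show ?case by (simp add: witt_nth_ge)
next
  case (Suc j)
  have "witt_nth (of_nat CHAR('a) ^ Suc j * x) i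
      = witt_nth (of_nat CHAR('a) * (of_nat CHAR('a) ^ j * x)) i"
    by (simp add: mult.assoc)
  moreover have "(a ^ (CHAR('a) ^ j)) ^ CHAR('a) = a ^ (CHAR('a) ^ Suc j)" for a :: 'a
    by (metis power_Suc2 power_mult)
  ultimately show ?case
    unfolding witt_nth_p_mult Suc by (auto simp: power_0_left simp del: power_Suc)
qed

lemma witt_nth_0_add:
  "witt_nth (x + y) 0 = witt_nth x 0 + witt_nth (y :: ('a::comm_ring_prime_char, 'n::finite) witt) 0"
  and witt_nth_0_mult: "witt_nth (x * y) 0 = witt_nth x 0 * witt_nth y 0"
  and witt_nth_0_0: "witt_nth (0 :: ('a, 'n) witt) i = 0"
  and witt_nth_1_0: "witt_nth (1 :: ('a, 'n) witt) 0 = 1"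
proof -
  have p: "prime CHAR('a)" by simp
  show "witt_nth (x + y) 0 = witt_nth x 0 + witt_nth y 0"
    using ghost_witt_add[OF p, of "witt_nth x" "witt_nth y" 0]
    by (simp add: plus_witt_def witt_nth_to_witt ghost_def)
  show "witt_nth (x * y) 0 = witt_nth x 0 * witt_nth y 0"
    using ghost_witt_mult[OF p, of "witt_nth x" "witt_nth y" 0]
    by (simp add: times_witt_def witt_nth_to_witt ghost_def)
  show "witt_nth (0 :: ('a, 'n) witt) i = 0" by (simp add: zero_witt_def witt_nth_to_witt)
  show "witt_nth (1 :: ('a, 'n) witt) 0 = 1" by (simp add: one_witt_def witt_nth_to_witt)
qed

lemma witt_nth_0_of_nat:
  "witt_nth (of_nat m :: ('a::comm_ring_prime_char, 'n::finite) witt) 0 = of_nat m"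
  by (induction m) (simp_all add: witt_nth_0_0 witt_nth_1_0 witt_nth_0_add)

lemma witt_p_power_CARD:
  "(of_nat CHAR('a) :: ('a::comm_ring_prime_char, 'n::finite) witt) ^ CARD('n) = 0"
  by (rule witt_eqI)
    (use witt_nth_p_power_mult[of "CARD('n)" "1 :: ('a, 'n) witt"] in \<open>simp add: witt_nth_0_0\<close>)

lemma perfect_root:
  assumes "\<forall>x::'a::comm_ring_1. \<exists>y. y ^ p = x"
  shows "\<exists>y. y ^ (p ^ j) = (x::'a)"
proof (induction j arbitrary: x)
  case (Suc j)
  obtain y where "y ^ p = x" using assms by auto
  moreover obtain z where "z ^ (p ^ j) = y" using Suc by auto
  ultimately have "z ^ (p ^ Suc j) = x" by (simp add: power_mult mult.commute[of p])
  then show ?case by blast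
qed simp

text \<open>Perfectness enters only here: it makes \<open>p\<^sup>j\<close>-th roots of the shifted components available.\<close>
lemma witt_p_power_dvd_iff:
  fixes x :: "('a::comm_ring_prime_char, 'n::finite) witt"
  assumes perfect: "\<forall>x::'a. \<exists>y. y ^ CHAR('a) = x"
  shows "of_nat CHAR('a) ^ j dvd x \<longleftrightarrow> (\<forall>i<j. witt_nth x i = 0)"
proof
  assume "of_nat CHAR('a) ^ j dvd x"
  then show "\<forall>i<j. witt_nth x i = 0" by (auto elim!: dvdE simp: witt_nth_p_power_mult)
next
  assume *: "\<forall>i<j. witt_nth x i = 0"
  obtain r where r: "\<And>x. r x ^ (CHAR('a) ^ j) = (x :: 'a)" using perfect_root[OF perfect] by metis
  have "x = of_nat CHAR('a) ^ j * to_witt (\<lambda>i. r (witt_nth x (i + j)))"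
    by (rule witt_eqI) (use * in \<open>auto simp: witt_nth_p_power_mult witt_nth_to_witt r\<close>)
  then show "of_nat CHAR('a) ^ j dvd x" by (metis dvd_triv_left)
qed

lemma witt_p_power_mult_eq_0:
  fixes x :: "('k::field_prime_char, 'n::finite) witt"
  assumes perfect: "\<forall>x::'k. \<exists>y. y ^ CHAR('k) = x"
    and "of_nat CHAR('k) ^ j * x = 0"
  shows "of_nat CHAR('k) ^ (CARD('n) - j) dvd x"
  unfolding witt_p_power_dvd_iff[OF perfect]
proof (intro allI impI)
  fix i assume "i < CARD('n) - j"
  then have "witt_nth x i ^ (CHAR('k) ^ j) = witt_nth (of_nat CHAR('k) ^ j * x) (i + j)"
    by (simp add: witt_nth_p_power_mult)
  then show "witt_nth x i = 0" using assms(2) by (simp add: witt_nth_0_0)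
qed

section \<open>Divided partial derivatives\<close>

lemma pol_lookup_of_nat_mult:
  "Poly_Mapping.lookup (of_nat c * f) m
      = of_nat c * Poly_Mapping.lookup (f :: ('d, 'a::comm_ring_1) pol) m"
  by (induction c) (simp_all add: distrib_right lookup_add)

lemma const_pol_mult_single:
  "const_pol c * Poly_Mapping.single m d = Poly_Mapping.single m (c * d :: 'a::comm_ring_1)"
  by (simp add: const_pol_def mult_single)

lemma of_nat_mult_single:
  "of_nat c * Poly_Mapping.single (m :: 'd \<Rightarrow>\<^sub>0 nat) d
      = Poly_Mapping.single m (of_nat c * d :: 'a::comm_ring_1)"
  by (rule poly_mapping_eqI) (simp add: pol_lookup_of_nat_mult lookup_single when_def)

lemma of_nat_dvd_pol_iff:
  "of_nat c dvd (f :: ('d, 'a::comm_ring_1) pol) \<longleftrightarrow> (\<forall>m. of_nat c dvd Poly_Mapping.lookup f m)"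
proof
  assume "of_nat c dvd f"
  then show "\<forall>m. of_nat c dvd Poly_Mapping.lookup f m"
    by (auto elim!: dvdE simp: pol_lookup_of_nat_mult)
next
  assume *: "\<forall>m. of_nat c dvd Poly_Mapping.lookup f m"
  have "of_nat c dvd Poly_Mapping.single m (Poly_Mapping.lookup f m)" for m
    using *[rule_format, of m] by (auto elim!: dvdE simp flip: of_nat_mult_single)
  then show "of_nat c dvd f" by (subst poly_mapping_sum_singles) (intro dvd_sum)
qed

lemma divided_partial_superset:
  assumes "finite S" "Poly_Mapping.keys f \<subseteq> S"
  shows "divided_partial j r f = (\<Sum>m\<in>S. Poly_Mapping.single (m - Poly_Mapping.single j r)
      (of_nat (Poly_Mapping.lookup m j choose r) * Poly_Mapping.lookup f m))"
  unfolding divided_partial_def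
  by (rule sum.mono_neutral_left) (use assms in \<open>auto simp: in_keys_iff\<close>)

lemma divided_partial_add: "divided_partial j r (f + g) = divided_partial j r f + divided_partial j r g"
proof -
  let ?S = "Poly_Mapping.keys f \<union> Poly_Mapping.keys g"
  have "Poly_Mapping.keys (f + g) \<subseteq> ?S" by (rule Poly_Mapping.keys_add)
  then show ?thesis
    by (simp add: divided_partial_superset[of ?S] lookup_add distrib_left single_add sum.distrib)
qed

lemma divided_partial_single [simp]:
  "divided_partial j r (Poly_Mapping.single m c)
    = Poly_Mapping.single (m - Poly_Mapping.single j r) (of_nat (Poly_Mapping.lookup m j choose r) * c)"
  by (subst divided_partial_superset[of "{m}"]) auto

lemma divided_partial_zero [simp]: "divided_partial j r 0 = 0"
  by (simp add: divided_partial_def)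

lemma divided_partial_const_mult:
  "divided_partial j r (const_pol c * f) = const_pol c * divided_partial j r f"
  by (induction f rule: pol_induct)
    (simp_all add: const_pol_mult_single distrib_left divided_partial_add mult.left_commute)

lemma lookup_divided_partial:
  "Poly_Mapping.lookup (divided_partial j r f) m
    = of_nat ((Poly_Mapping.lookup m j + r) choose r)
      * Poly_Mapping.lookup f (m + Poly_Mapping.single j r)"
proof (induction f rule: pol_induct)
  case (single a c)
  show ?case
  proof (cases "a = m + Poly_Mapping.single j r")
    case True
    then show ?thesis by (simp add: lookup_add)
  next
    case False
    have "a = m + Poly_Mapping.single j r"
      if "a - Poly_Mapping.single j r = m" "r \<le> Poly_Mapping.lookup a j"
      by (rule poly_mapping_eqI)
        (use that in \<open>auto simp: lookup_add lookup_minus lookup_single when_def\<close>)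
    with False have "a - Poly_Mapping.single j r \<noteq> m \<or> Poly_Mapping.lookup a j < r" by (metis not_le)
    with False show ?thesis by (auto simp: lookup_single binomial_eq_0)
  qed
next
  case (add f g)
  then show ?case by (simp add: divided_partial_add lookup_add distrib_left)
qed

lemma divided_partial_0_order: "divided_partial j 0 = id"
  by (rule ext, rule poly_mapping_eqI) (simp add: lookup_divided_partial)

lemma divided_partial_mult:
  "divided_partial j i (f * g) = (\<Sum>a\<le>i. divided_partial j a f * divided_partial j (i - a) g)"
proof (induction f rule: pol_induct)
  case (single m c)
  show ?case
  proof (induction g rule: pol_induct)
    case (single n d)
    let ?m = "Poly_Mapping.lookup m j" and ?n = "Poly_Mapping.lookup n j"
    let ?f = "Poly_Mapping.single m c" and ?g = "Poly_Mapping.single n d"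
    let ?e = "m + n - Poly_Mapping.single j i"
    let ?b = "\<lambda>a. of_nat ((?m choose a) * (?n choose (i - a))) * (c * d)"
    have t: "divided_partial j a ?f * divided_partial j (i - a) ?g = Poly_Mapping.single ?e (?b a)"
      if "a \<le> i" for a
    proof (cases "a \<le> ?m \<and> i - a \<le> ?n")
      case True
      then have "m - Poly_Mapping.single j a + (n - Poly_Mapping.single j (i - a)) = ?e"
        by (intro poly_mapping_eqI)
          (use that in \<open>auto simp: lookup_add lookup_minus lookup_single when_def\<close>)
      then show ?thesis by (simp add: mult_single mult_ac)
    qed (auto simp: not_le binomial_eq_0)
    have "(\<Sum>a\<le>i. divided_partial j a ?f * divided_partial j (i - a) ?g)
        = (\<Sum>a\<le>i. Poly_Mapping.single ?e (?b a))"
      by (rule sum.cong) (use t in auto)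
    also have "\<dots> = Poly_Mapping.single ?e (\<Sum>a\<le>i. ?b a)"
      by (induction rule: infinite_finite_induct[of _ "{..i}"]) (simp_all add: single_add)
    also have "(\<Sum>a\<le>i. ?b a) = of_nat ((?m + ?n) choose i) * (c * d)"
      unfolding sum_distrib_right[symmetric] of_nat_sum[symmetric] vandermonde ..
    finally show ?case by (simp add: mult_single lookup_add)
  qed (simp add: distrib_left divided_partial_add sum.distrib)
qed (simp add: distrib_right divided_partial_add sum.distrib)

section \<open>Composition and order of differential operators\<close>
lemma alg_linear_add: "alg_linear \<rho> \<delta> \<Longrightarrow> \<delta> (x + y) = \<delta> x + \<delta> y"
  by (simp add: alg_linear_def)

lemma alg_linear_zero: "alg_linear \<rho> \<delta> \<Longrightarrow> \<delta> 0 = 0"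
  using alg_linear_add[of \<rho> \<delta> 0 0] by simp

lemma alg_linear_diff: "alg_linear \<rho> \<delta> \<Longrightarrow> \<delta> (x - y) = \<delta> x - \<delta> y"
  using alg_linear_add[of \<rho> \<delta> "x - y" y] by simp

lemma diff_ops_le_linear: "\<delta> \<in> diff_ops_le \<rho> m \<Longrightarrow> alg_linear \<rho> \<delta>"
  by (cases m) auto

lemma diff_ops_le_zero: "(\<lambda>_. 0) \<in> diff_ops_le \<rho> m"
  by (induction m) (simp_all add: alg_linear_def)

lemma diff_ops_le_add:
  "\<delta> \<in> diff_ops_le \<rho> m \<Longrightarrow> \<epsilon> \<in> diff_ops_le \<rho> m \<Longrightarrow> (\<lambda>x. \<delta> x + \<epsilon> x) \<in> diff_ops_le \<rho> m"
proof (induction m arbitrary: \<delta> \<epsilon>)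
  case (Suc m)
  have "(\<lambda>x. (\<delta> (a * x) - a * \<delta> x) + (\<epsilon> (a * x) - a * \<epsilon> x)) \<in> diff_ops_le \<rho> m" for a
    by (rule Suc.IH) (use Suc.prems in auto)
  moreover have "(\<lambda>x. \<delta> (a * x) + \<epsilon> (a * x) - a * (\<delta> x + \<epsilon> x))
      = (\<lambda>x. (\<delta> (a * x) - a * \<delta> x) + (\<epsilon> (a * x) - a * \<epsilon> x))" for a
    by (simp add: fun_eq_iff algebra_simps)
  ultimately show ?case using Suc.prems by (simp add: alg_linear_def distrib_left add_ac)
qed (simp add: alg_linear_def distrib_left add_ac)

lemma diff_ops_le_mult: "\<delta> \<in> diff_ops_le \<rho> m \<Longrightarrow> (\<lambda>x. b * \<delta> x) \<in> diff_ops_le \<rho> m"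
proof (induction m arbitrary: \<delta>)
  case (Suc m)
  have "(\<lambda>x. b * (\<delta> (a * x) - a * \<delta> x)) \<in> diff_ops_le \<rho> m" for a
    by (rule Suc.IH) (use Suc.prems in auto)
  moreover have "(\<lambda>x. b * \<delta> (a * x) - a * (b * \<delta> x)) = (\<lambda>x. b * (\<delta> (a * x) - a * \<delta> x))" for a
    by (simp add: fun_eq_iff right_diff_distrib mult.left_commute)
  ultimately show ?case using Suc.prems by (simp add: alg_linear_def distrib_left mult.left_commute)
qed (simp add: alg_linear_def distrib_left mult.left_commute)

lemma diff_ops_le_Suc: "\<delta> \<in> diff_ops_le \<rho> m \<Longrightarrow> \<delta> \<in> diff_ops_le \<rho> (Suc m)"
proof (induction m arbitrary: \<delta>)
  case 0
  then have "(\<lambda>x. \<delta> (a * x) - a * \<delta> x) = (\<lambda>_. 0)" for a by auto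
  with 0 show ?case using diff_ops_le_zero[of \<rho> 0] by simp
next
  case (Suc m)
  then have *: "alg_linear \<rho> \<delta>" "\<And>a. (\<lambda>x. \<delta> (a * x) - a * \<delta> x) \<in> diff_ops_le \<rho> m" by auto
  then show ?case by (subst diff_ops_le.simps(2)) (use Suc.IH in blast)
qed

lemma diff_ops_le_mono: "m \<le> n \<Longrightarrow> \<delta> \<in> diff_ops_le \<rho> m \<Longrightarrow> \<delta> \<in> diff_ops_le \<rho> n"
  by (induction n rule: dec_induct) (blast intro: diff_ops_le_Suc)+

lemma diff_ops_le_sum:
  "(\<And>i. i \<in> S \<Longrightarrow> \<delta> i \<in> diff_ops_le \<rho> m) \<Longrightarrow> (\<lambda>x. \<Sum>i\<in>S. \<delta> i x) \<in> diff_ops_le \<rho> m"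
proof (induction S rule: infinite_finite_induct)
  case (insert i S)
  then have "(\<lambda>x. \<delta> i x + (\<Sum>i\<in>S. \<delta> i x)) \<in> diff_ops_le \<rho> m"
    by (intro diff_ops_le_add) blast+
  then show ?case using insert.hyps by (simp del: diff_ops_le.simps)
qed (simp_all add: diff_ops_le_zero del: diff_ops_le.simps)

lemma diff_ops_le_diff:
  assumes "\<delta> \<in> diff_ops_le \<rho> m" "\<epsilon> \<in> diff_ops_le \<rho> m"
  shows "(\<lambda>x. \<delta> x - \<epsilon> x) \<in> diff_ops_le \<rho> m"
  using diff_ops_le_add[OF assms(1) diff_ops_le_mult[OF assms(2), of "- 1"]] by simp

lemma diff_ops_le_comp:
  "\<delta> \<in> diff_ops_le \<rho> m \<Longrightarrow> \<epsilon> \<in> diff_ops_le \<rho> n \<Longrightarrow> \<delta> \<circ> \<epsilon> \<in> diff_ops_le \<rho> (m + n)"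
proof (induction m arbitrary: \<delta> \<epsilon> n)
  case 0
  have "\<delta> x = \<delta> 1 * x" for x
  proof -
    have "\<delta> (x * 1) = x * \<delta> 1" using 0(1) unfolding diff_ops_le.simps by blast
    then show ?thesis by (simp add: mult.commute)
  qed
  then have "\<delta> \<circ> \<epsilon> = (\<lambda>x. \<delta> 1 * \<epsilon> x)" unfolding comp_def by (intro ext)
  then show ?case using diff_ops_le_mult[OF 0(2), of "\<delta> 1"] by (simp only: add_0)
next
  case (Suc m)
  note m = Suc.IH and \<delta> = Suc.prems(1)
  have lin: "alg_linear \<rho> (\<delta> \<circ> \<epsilon>)" if "\<epsilon> \<in> diff_ops_le \<rho> n" for \<epsilon> n
    using diff_ops_le_linear[OF that] diff_ops_le_linear[OF \<delta>] by (simp add: alg_linear_def)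
  note lin = lin[unfolded comp_def]
  have br: "(\<lambda>x. \<delta> (a * x) - a * \<delta> x) \<in> diff_ops_le \<rho> m" for a using \<delta> by simp
  have eq: "(\<lambda>x. \<delta> (\<epsilon> (a * x)) - a * \<delta> (\<epsilon> x))
      = (\<lambda>x. (\<delta> \<circ> (\<lambda>x. \<epsilon> (a * x) - a * \<epsilon> x)) x + ((\<lambda>x. \<delta> (a * x) - a * \<delta> x) \<circ> \<epsilon>) x)"
    for a \<epsilon>
    using alg_linear_diff[OF diff_ops_le_linear[OF \<delta>]] by (simp add: fun_eq_iff)
  from Suc.prems(2) show ?case
  proof (induction n arbitrary: \<epsilon>)
    case 0
    then have "\<delta> \<circ> (\<lambda>x. \<epsilon> (a * x) - a * \<epsilon> x) = (\<lambda>_. 0)" for a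
      using alg_linear_zero[OF diff_ops_le_linear[OF \<delta>]] by (auto simp: fun_eq_iff)
    then have "(\<lambda>x. \<delta> (\<epsilon> (a * x)) - a * \<delta> (\<epsilon> x)) \<in> diff_ops_le \<rho> m" for a
      unfolding eq using m[OF br 0, of a] by (simp add: comp_def)
    then show ?case using lin[OF 0] by simp
  next
    case (Suc n)
    have "\<delta> \<circ> (\<lambda>x. \<epsilon> (a * x) - a * \<epsilon> x) \<in> diff_ops_le \<rho> (Suc m + n)" for a
      by (rule Suc.IH) (use Suc.prems in simp)
    moreover have "(\<lambda>x. \<delta> (a * x) - a * \<delta> x) \<circ> \<epsilon> \<in> diff_ops_le \<rho> (Suc m + n)" for a
      using m[OF br Suc.prems, of a] by (simp only: add_Suc_shift)
    ultimately have "(\<lambda>x. \<delta> (\<epsilon> (a * x)) - a * \<delta> (\<epsilon> x)) \<in> diff_ops_le \<rho> (Suc m + n)" for a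
      unfolding eq by (rule diff_ops_le_add)
    then show ?case using lin[OF Suc.prems] by simp
  qed
qed

lemma id_in_diff_ops_le: "id \<in> diff_ops_le \<rho> 0"
  by (simp add: alg_linear_def)

text \<open>By the Leibniz rule, the commutator of \<open>\<partial>\<^sup>[\<^sup>r\<^sup>]\<close> with multiplication by \<open>a\<close> is \<open>\<Sum>\<^bsub>1\<le>l\<le>r\<^esub>
\<partial>\<^sup>[\<^sup>l\<^sup>](a) \<partial>\<^sup>[\<^sup>r\<^sup>-\<^sup>l\<^sup>]\<close>, which has lower order by induction.\<close>
lemma divided_partial_in_diff_ops_le:
  "(divided_partial j r :: ('d, 'a::comm_ring_1) pol \<Rightarrow> ('d, 'a) pol) \<in> diff_ops_le const_pol r"
proof (induction r rule: less_induct)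
  case (less r)
  have lin: "alg_linear const_pol (divided_partial j r :: ('d, 'a) pol \<Rightarrow> ('d, 'a) pol)"
    by (simp add: alg_linear_def divided_partial_add divided_partial_const_mult)
  show ?case
  proof (cases r)
    case 0
    then show ?thesis by (simp add: divided_partial_0_order alg_linear_def)
  next
    case (Suc q)
    have "divided_partial j r (a * x) - a * divided_partial j r x
        = (\<Sum>l\<in>{1..r}. divided_partial j l a * divided_partial j (r - l) x)" for a x :: "('d, 'a) pol"
    proof -
      have "{..r} = insert 0 {1..r}" by auto
      then show ?thesis by (simp add: divided_partial_mult divided_partial_0_order)
    qed
    moreover have "(\<lambda>x. \<Sum>l\<in>{1..r}. divided_partial j l a * divided_partial j (r - l) x)
        \<in> diff_ops_le const_pol q" for a :: "('d, 'a) pol"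
    proof (intro diff_ops_le_sum diff_ops_le_mult)
      fix l assume "l \<in> {1..r}"
      then have "r - l < r" "r - l \<le> q" using Suc by auto
      then show "(divided_partial j (r - l) :: ('d, 'a) pol \<Rightarrow> ('d, 'a) pol) \<in> diff_ops_le const_pol q"
        using diff_ops_le_mono less.IH by blast
    qed
    ultimately show ?thesis using lin unfolding Suc by simp
  qed
qed

section \<open>Differential operators of polynomial rings in terms of divided powers\<close>
lemma multi_op_induct:
  assumes "P id" "\<And>j g. P g \<Longrightarrow> P (D j (Poly_Mapping.lookup r j) \<circ> g)"
  shows "P (multi_op D r)"
proof -
  let ?F = "\<lambda>js. foldr (\<lambda>j g. D j (Poly_Mapping.lookup r j) \<circ> g) js id"
  have F: "?F [] = id" "?F (j # js) = D j (Poly_Mapping.lookup r j) \<circ> ?F js" for j js by simp_all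
  have "P (?F js)" for js
    by (induction js) (unfold F, rule assms, rule assms)
  then show ?thesis by (simp add: multi_op_def)
qed

text \<open>The multi-index binomial coefficient \<open>\<Prod>\<^sub>j (m\<^sub>j choose r\<^sub>j)\<close>.\<close>
definition mbinom :: "('d::finite \<Rightarrow>\<^sub>0 nat) \<Rightarrow> ('d \<Rightarrow>\<^sub>0 nat) \<Rightarrow> nat"
  where "mbinom m r = (\<Prod>j\<in>UNIV. Poly_Mapping.lookup m j choose Poly_Mapping.lookup r j)"

text \<open>The total degree \<open>\<Sum>\<^sub>j r\<^sub>j\<close> of a multi-index.\<close>
definition mdeg :: "('d::finite \<Rightarrow>\<^sub>0 nat) \<Rightarrow> nat"
  where "mdeg r = (\<Sum>j\<in>UNIV. Poly_Mapping.lookup r j)"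

lemma sum_single_UNIV:
  "(\<Sum>j\<in>UNIV. Poly_Mapping.single j (Poly_Mapping.lookup r j)) = (r :: 'd::finite \<Rightarrow>\<^sub>0 nat)"
  by (rule poly_mapping_eqI) (simp add: lookup_sum lookup_single when_def)

lemma multi_op_divided_partial_single:
  "multi_op divided_partial r (Poly_Mapping.single m c)
    = Poly_Mapping.single (m - r) (of_nat (mbinom m r) * (c :: 'a::comm_ring_1))"
proof -
  let ?F = "\<lambda>js. foldr (\<lambda>j g. divided_partial j (Poly_Mapping.lookup r j) \<circ> g) js id"
  have "?F js (Poly_Mapping.single m c)
      = Poly_Mapping.single (m - (\<Sum>j\<in>set js. Poly_Mapping.single j (Poly_Mapping.lookup r j)))
      (of_nat (\<Prod>j\<in>set js. Poly_Mapping.lookup m j choose Poly_Mapping.lookup r j) * c)"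
    if "distinct js" for js
    using that
  proof (induction js)
    case (Cons j js)
    have "Poly_Mapping.lookup (m - (\<Sum>j\<in>set js. Poly_Mapping.single j (Poly_Mapping.lookup r j))) j
        = Poly_Mapping.lookup m j"
      using Cons.prems by (simp add: lookup_minus lookup_sum lookup_single when_def)
    then show ?case using Cons by (simp add: diff_diff_eq add.commute mult.assoc)
  qed simp
  from this[of "sorted_list_of_set UNIV"] show ?thesis
    by (simp add: multi_op_def mbinom_def sum_single_UNIV)
qed

lemma multi_op_divided_partial_add:
  "multi_op divided_partial r (f + g) = multi_op divided_partial r f + multi_op divided_partial r g"
proof -
  have "\<forall>f g. multi_op divided_partial r (f + g)
      = multi_op divided_partial r f + multi_op divided_partial r g"
    by (rule multi_op_induct) (simp_all add: divided_partial_add)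
  then show ?thesis by blast
qed

lemma multi_op_divided_partial_in_diff_ops_le:
  "(multi_op divided_partial r :: ('d::{finite,linorder}, 'a::comm_ring_1) pol \<Rightarrow> ('d, 'a) pol)
      \<in> diff_ops_le const_pol (mdeg r)"
proof -
  let ?F = "\<lambda>js. foldr (\<lambda>j g. divided_partial j (Poly_Mapping.lookup r j) \<circ> g) js id
    :: ('d, 'a) pol \<Rightarrow> ('d, 'a) pol"
  have F: "?F (j # js) = divided_partial j (Poly_Mapping.lookup r j) \<circ> ?F js" for j js by simp
  have "?F js \<in> diff_ops_le const_pol (\<Sum>j\<in>set js. Poly_Mapping.lookup r j)" if "distinct js" for js
    using that
  proof (induction js)
    case (Cons j js)
    then have "?F js \<in> diff_ops_le const_pol (\<Sum>j\<in>set js. Poly_Mapping.lookup r j)"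
      by (simp only: distinct.simps)
    from diff_ops_le_comp[OF divided_partial_in_diff_ops_le this]
    show ?case
      unfolding F using Cons.prems by (simp del: foldr.simps comp_apply id_apply)
  qed (use id_in_diff_ops_le in simp)
  from this[of "sorted_list_of_set UNIV"] show ?thesis
    by (simp add: multi_op_def mdeg_def)
qed

lemma op_sum_superset:
  assumes "finite S" "\<And>r. c r \<noteq> 0 \<Longrightarrow> r \<in> S"
  shows "op_sum c D f = (\<Sum>r\<in>S. c r * multi_op D r f)"
  unfolding op_sum_def by (rule sum.mono_neutral_left) (use assms in auto)

lemma mdeg_add: "mdeg (r + s) = mdeg r + mdeg s"
  by (simp add: mdeg_def lookup_add sum.distrib)

lemma mdeg_single [simp]: "mdeg (Poly_Mapping.single j i) = i"
  by (simp add: mdeg_def lookup_single when_def)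

lemma mdeg_eq_0_iff: "mdeg r = 0 \<longleftrightarrow> r = 0"
  by (auto simp: mdeg_def intro!: poly_mapping_eqI)

lemma finite_mdeg_le: "finite {r :: 'd::finite \<Rightarrow>\<^sub>0 nat. mdeg r \<le> m}"
proof (rule finite_imageD)
  have "Poly_Mapping.lookup r j \<le> m" if "mdeg r \<le> m" for r :: "'d \<Rightarrow>\<^sub>0 nat" and j
    using that member_le_sum[of j UNIV "Poly_Mapping.lookup r"] by (simp add: mdeg_def)
  then have "Poly_Mapping.lookup ` {r :: 'd \<Rightarrow>\<^sub>0 nat. mdeg r \<le> m} \<subseteq> (\<Pi>\<^sub>E j\<in>UNIV. {..m})"
    by auto
  then show "finite (Poly_Mapping.lookup ` {r :: 'd \<Rightarrow>\<^sub>0 nat. mdeg r \<le> m})"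
    by (rule finite_subset) (intro finite_PiE; simp)
  show "inj_on Poly_Mapping.lookup {r :: 'd \<Rightarrow>\<^sub>0 nat. mdeg r \<le> m}"
    by (auto intro!: inj_onI poly_mapping_eqI)
qed

lemma op_sum_in_diff_ops_le:
  fixes c :: "('d::{finite,linorder} \<Rightarrow>\<^sub>0 nat) \<Rightarrow> ('d, 'a::comm_ring_1) pol"
  assumes "\<And>r. c r \<noteq> 0 \<Longrightarrow> mdeg r \<le> m"
  shows "op_sum c divided_partial \<in> diff_ops_le const_pol m"
proof -
  have "op_sum c divided_partial = (\<lambda>f. \<Sum>r\<in>{r. mdeg r \<le> m}. c r * multi_op divided_partial r f)"
    by (rule ext, rule op_sum_superset) (use assms finite_mdeg_le in auto)
  also have "\<dots> \<in> diff_ops_le const_pol m"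
    by (intro diff_ops_le_sum diff_ops_le_mult)
      (use diff_ops_le_mono multi_op_divided_partial_in_diff_ops_le in blast)
  finally show ?thesis .
qed

lemma pol_split_var:
  assumes "s \<noteq> 0"
  obtains j u where "s = Poly_Mapping.single j 1 + (u :: 'd::finite \<Rightarrow>\<^sub>0 nat)"
proof -
  obtain j where "Poly_Mapping.lookup s j \<noteq> 0" using assms by (metis lookup_zero poly_mapping_eqI)
  then have "s = Poly_Mapping.single j 1 + (s - Poly_Mapping.single j 1)"
    by (intro poly_mapping_eqI) (auto simp: lookup_add lookup_minus lookup_single when_def)
  then show ?thesis by (rule that)
qed

text \<open>An operator of order at most \<open>m\<close> is determined by its values on the monomials of degree at
most \<open>m\<close>: if these vanish, then by induction on \<open>m\<close> the operator commutes with every variable.\<close>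
lemma diff_ops_le_eq_0:
  fixes \<delta> :: "('d::finite, 'a::comm_ring_1) pol \<Rightarrow> ('d, 'a) pol"
  assumes "\<delta> \<in> diff_ops_le const_pol m"
    and "\<And>s. mdeg s \<le> m \<Longrightarrow> \<delta> (Poly_Mapping.single s 1) = 0"
  shows "\<delta> f = 0"
  using assms
proof (induction m arbitrary: \<delta> f)
  case 0
  have "\<delta> (f * 1) = f * \<delta> 1" using 0(1) unfolding diff_ops_le.simps by blast
  moreover have "\<delta> 1 = 0" using 0(2)[of 0] by (simp add: mdeg_eq_0_iff)
  ultimately show ?case by simp
next
  case (Suc m)
  have lin: "alg_linear const_pol \<delta>" using Suc.prems(1) by simp
  have comm: "\<delta> (Poly_Mapping.single (Poly_Mapping.single j 1) 1 * x)
      = Poly_Mapping.single (Poly_Mapping.single j 1) 1 * \<delta> x" for j x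
  proof -
    let ?t = "Poly_Mapping.single (Poly_Mapping.single j 1) 1 :: ('d, 'a) pol"
    have "(\<lambda>x. \<delta> (?t * x) - ?t * \<delta> x) \<in> diff_ops_le const_pol m" using Suc.prems(1) by simp
    then have "\<delta> (?t * x) - ?t * \<delta> x = 0"
      by (rule Suc.IH) (use Suc.prems(2) in \<open>simp add: mult_single mdeg_add\<close>)
    then show ?thesis by simp
  qed
  have mon: "\<delta> (Poly_Mapping.single s 1) = 0" for s
  proof (induction "mdeg s" arbitrary: s)
    case 0
    then show ?case using Suc.prems(2) by simp
  next
    case (Suc n)
    then obtain j u where s: "s = Poly_Mapping.single j 1 + u"
      by (metis mdeg_eq_0_iff nat.distinct(1) pol_split_var)
    have "mdeg u = n" using Suc(2) by (simp add: s mdeg_add)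
    then have "\<delta> (Poly_Mapping.single (Poly_Mapping.single j 1) 1 * Poly_Mapping.single u 1) = 0"
      unfolding comm using Suc(1) by simp
    then show ?case by (simp add: s mult_single)
  qed
  show ?case
  proof (induction f rule: pol_induct)
    case (single s c)
    have "\<delta> (const_pol c * Poly_Mapping.single s 1) = const_pol c * \<delta> (Poly_Mapping.single s 1)"
      using lin by (simp add: alg_linear_def)
    then show ?case by (simp add: const_pol_mult_single mon)
  next
    case (add f g)
    then show ?case using lin by (simp add: alg_linear_def)
  qed
qed

lemma mbinom_self [simp]: "mbinom r r = 1"
  by (simp add: mbinom_def)

lemma mbinom_eq_0:
  assumes "mdeg s \<le> mdeg r" "r \<noteq> s"
  shows "mbinom s r = 0"
proof (rule ccontr)
  assume "mbinom s r \<noteq> 0"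
  then have le: "Poly_Mapping.lookup r j \<le> Poly_Mapping.lookup s j" for j
    by (auto simp: mbinom_def binomial_eq_0_iff not_less)
  have "r = s"
  proof (rule poly_mapping_eqI, rule ccontr)
    fix j assume "Poly_Mapping.lookup r j \<noteq> Poly_Mapping.lookup s j"
    then have "mdeg r < mdeg s" unfolding mdeg_def
      by (intro sum_strict_mono_ex1) (use le in \<open>auto intro!: exI[of _ j] simp: less_le\<close>)
    then show False using assms by simp
  qed
  then show False using assms by simp
qed

text \<open>Conversely, the values on the monomials of degree below \<open>m\<close> can be prescribed. A term \<open>b\<^sub>r
\<partial>\<^sup>[\<^sup>r\<^sup>]\<close> with \<open>r\<close> of degree \<open>m\<close> changes the values in degrees up to \<open>m\<close> at \<open>t\<^sup>r\<close> only, where it adds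
\<open>b\<^sub>r\<close>.\<close>
lemma op_sum_interpolation:
  fixes \<theta> :: "('d::{finite,linorder}, 'a::comm_ring_1) pol \<Rightarrow> ('d, 'a) pol"
  shows "\<exists>b. (\<forall>r. b r \<noteq> 0 \<longrightarrow> mdeg r < m)
    \<and> (\<forall>s. mdeg s < m
        \<longrightarrow> op_sum b divided_partial (Poly_Mapping.single s 1) = \<theta> (Poly_Mapping.single s 1))"
proof (induction m)
  case 0
  show ?case by (rule exI[of _ "\<lambda>_. 0"]) simp
next
  case (Suc m)
  then obtain b where b: "\<And>r. b r \<noteq> 0 \<Longrightarrow> mdeg r < m"
    "\<And>s. mdeg s < m \<Longrightarrow> op_sum b divided_partial (Poly_Mapping.single s 1) = \<theta> (Poly_Mapping.single s 1)"
    by blast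
  let ?e = "\<lambda>s. Poly_Mapping.single s 1 :: ('d, 'a) pol"
  define b' where "b' r = (if mdeg r = m then \<theta> (?e r) - op_sum b divided_partial (?e r) else b r)"
    for r
  let ?S = "{r :: 'd \<Rightarrow>\<^sub>0 nat. mdeg r \<le> m}" and ?T = "{r :: 'd \<Rightarrow>\<^sub>0 nat. mdeg r = m}"
  have fin: "finite ?S" by (rule finite_mdeg_le)
  have b'_supp: "mdeg r \<le> m" if "b' r \<noteq> 0" for r
    using that b(1)[of r] by (auto simp: b'_def split: if_splits)
  have "op_sum b' divided_partial (?e s) = \<theta> (?e s)" if s: "mdeg s \<le> m" for s
  proof -
    have "op_sum b' divided_partial (?e s) = (\<Sum>r\<in>?S. b' r * multi_op divided_partial r (?e s))"
      by (rule op_sum_superset) (use fin b'_supp in auto)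
    also have "\<dots> = (\<Sum>r\<in>?S. b r * multi_op divided_partial r (?e s) + (if r = s then b' s - b s else 0))"
    proof (rule sum.cong)
      fix r assume r: "r \<in> ?S"
      show "b' r * multi_op divided_partial r (?e s)
          = b r * multi_op divided_partial r (?e s) + (if r = s then b' s - b s else 0)"
      proof (cases "mdeg r = m")
        case True
        then show ?thesis using s b(1)[of r] mbinom_eq_0[of s r]
          by (auto simp: multi_op_divided_partial_single)
      qed (auto simp: b'_def)
    qed simp
    also have "\<dots> = op_sum b divided_partial (?e s) + (b' s - b s)"
      unfolding sum.distrib
      by (subst op_sum_superset[of ?S]) (use fin b(1) s in \<open>auto dest: less_imp_le\<close>)
    also have "\<dots> = \<theta> (?e s)"
      using b(1)[of s] b(2)[of s] s by (cases "mdeg s = m") (auto simp: b'_def)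
    finally show ?thesis .
  qed
  then show ?case using b'_supp by (intro exI[of _ b']) (auto simp: less_Suc_eq_le)
qed

theorem pol_diff_ops_eq_op_sum:
  fixes \<theta> :: "('d::{finite,linorder}, 'a::comm_ring_1) pol \<Rightarrow> ('d, 'a) pol"
  assumes "\<theta> \<in> pol_diff_ops"
  obtains b where "finite {r. b r \<noteq> 0}" "\<theta> = op_sum b divided_partial"
proof -
  obtain m where m: "\<theta> \<in> diff_ops_le const_pol m"
    using assms by (auto simp: pol_diff_ops_def diff_ops_def)
  obtain b where b: "\<And>r. b r \<noteq> 0 \<Longrightarrow> mdeg r \<le> m"
    "\<And>s. mdeg s \<le> m \<Longrightarrow> op_sum b divided_partial (Poly_Mapping.single s 1) = \<theta> (Poly_Mapping.single s 1)"
    using op_sum_interpolation[of "Suc m" \<theta>] by (auto simp: less_Suc_eq_le)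
  have "(\<lambda>f. \<theta> f - op_sum b divided_partial f) \<in> diff_ops_le const_pol m"
    by (intro diff_ops_le_diff m op_sum_in_diff_ops_le b)
  then have "\<theta> f - op_sum b divided_partial f = 0" for f
    by (rule diff_ops_le_eq_0) (simp add: b)
  then have "\<theta> = op_sum b divided_partial" by (simp add: fun_eq_iff)
  moreover have "finite {r. b r \<noteq> 0}"
    by (rule finite_subset[OF _ finite_mdeg_le[of m]]) (use b in auto)
  ultimately show ?thesis by (rule that[rotated])
qed

section \<open>Reduction modulo \<open>p\<close> and the kernel of the ghost map\<close>
lemma witt_nth_0_diff:
  "witt_nth (x - y) 0 = witt_nth x 0 - witt_nth (y :: ('a::comm_ring_prime_char, 'n::finite) witt) 0"
  using witt_nth_0_add[of "x - y" y] by (simp add: eq_diff_eq)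

lemma lookup_pol_red:
  "Poly_Mapping.lookup (pol_red (f :: ('d, ('k::comm_ring_prime_char, 'n::finite) witt) pol)) m
      = witt_nth (Poly_Mapping.lookup f m) 0"
  by (simp add: pol_red_def Poly_Mapping.map.rep_eq when_def witt_nth_0_0)

lemma pol_red_zero [simp]: "pol_red 0 = 0"
  by (rule poly_mapping_eqI) (simp add: lookup_pol_red witt_nth_0_0)

lemma pol_red_single [simp]: "pol_red (Poly_Mapping.single m c) = Poly_Mapping.single m (witt_nth c 0)"
  by (rule poly_mapping_eqI) (simp add: lookup_pol_red lookup_single when_def witt_nth_0_0)

lemma pol_red_one [simp]: "pol_red 1 = 1"
  by (simp add: witt_nth_1_0 flip: single_one)

lemma pol_red_add: "pol_red (f + g) = pol_red f + pol_red g"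
  by (rule poly_mapping_eqI) (simp add: lookup_pol_red lookup_add witt_nth_0_add)

lemma pol_red_mult: "pol_red (f * g) = pol_red f * pol_red g"
proof (induction f rule: pol_induct)
  case (single m c)
  show ?case
    by (induction g rule: pol_induct)
      (simp_all add: mult_single witt_nth_0_mult distrib_left pol_red_add)
qed (simp add: distrib_right pol_red_add)

lemma pol_red_power: "pol_red (f ^ i) = pol_red f ^ i"
  by (induction i) (simp_all add: pol_red_mult)

lemma pol_red_sum: "pol_red (sum f S) = (\<Sum>i\<in>S. pol_red (f i))"
  by (induction S rule: infinite_finite_induct) (simp_all add: pol_red_add)

lemma pol_red_of_nat_CHAR: "pol_red (of_nat CHAR('k) * f) = (0 :: ('d, 'k::comm_ring_prime_char) pol)"
  by (rule poly_mapping_eqI) (simp add: lookup_pol_red pol_lookup_of_nat_mult witt_nth_p_mult)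

lemma pol_red_divided_partial: "pol_red (divided_partial j r f) = divided_partial j r (pol_red f)"
  by (rule poly_mapping_eqI)
    (simp add: lookup_pol_red lookup_divided_partial witt_nth_0_mult witt_nth_0_of_nat)

lemma pol_red_multi_op:
  "pol_red (multi_op divided_partial r f) = multi_op divided_partial r (pol_red f)"
proof (induction f rule: pol_induct)
  case (single m c)
  show ?case by (simp add: multi_op_divided_partial_single witt_nth_0_mult witt_nth_0_of_nat)
qed (simp add: multi_op_divided_partial_add pol_red_add)

lemma pol_red_surj: "\<exists>f :: ('d, ('k::comm_ring_prime_char, 'n::finite) witt) pol. pol_red f = g"
proof (induction g rule: pol_induct)
  case (single m c)
  have "pol_red (Poly_Mapping.single m (to_witt (\<lambda>_. c) :: ('k, 'n) witt)) = Poly_Mapping.single m c"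
    by (simp add: witt_nth_to_witt)
  then show ?case ..
next
  case (add f g)
  then show ?case by (metis pol_red_add)
qed

lemma pol_red_eqD:
  fixes f g :: "('d, ('k::comm_ring_prime_char, 'n::finite) witt) pol"
  assumes perfect: "\<forall>x::'k. \<exists>y. y ^ CHAR('k) = x" and eq: "pol_red f = pol_red g"
  shows "of_nat CHAR('k) dvd f - g"
  unfolding of_nat_dvd_pol_iff
proof
  fix m
  have "witt_nth (Poly_Mapping.lookup (f - g) m) 0 = 0"
    using arg_cong[OF eq, of "\<lambda>f. Poly_Mapping.lookup f m"]
    by (simp add: lookup_pol_red lookup_minus witt_nth_0_diff)
  then show "of_nat CHAR('k) dvd Poly_Mapping.lookup (f - g) m"
    using witt_p_power_dvd_iff[OF perfect, of 1 "Poly_Mapping.lookup (f - g) m"] by simp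
qed

lemma pol_p_power_eq_0:
  assumes "CARD('n) \<le> i"
  shows "(of_nat CHAR('k) :: ('d, ('k::comm_ring_prime_char, 'n::finite) witt) pol) ^ i = 0"
proof -
  have "of_nat (CHAR('k) ^ CARD('n)) = (0 :: ('k, 'n) witt)"
    using witt_p_power_CARD[where 'a='k and 'n='n] by simp
  then have "of_nat (CHAR('k) ^ CARD('n)) = (0 :: ('d, ('k, 'n) witt) pol)"
    by (simp del: of_nat_power single_of_nat flip: single_of_nat)
  then have "(of_nat CHAR('k) :: ('d, ('k, 'n) witt) pol) ^ CARD('n) = 0" by simp
  then show ?thesis using assms by (metis le_iff_add mult_zero_left power_add)
qed

lemma witt_p_power_dvd_eq_0:
  assumes "CARD('n) \<le> i" "of_nat CHAR('k) ^ i dvd (x :: ('k::comm_ring_prime_char, 'n::finite) witt)"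
  shows "x = 0"
proof -
  have "of_nat CHAR('k) ^ CARD('n) dvd x" using assms by (meson dvd_trans le_imp_power_dvd)
  then show ?thesis by (simp add: witt_p_power_CARD)
qed

lemma pol_p_power_mult_eq_0:
  fixes f :: "('d, ('k::field_prime_char, 'n::finite) witt) pol"
  assumes perfect: "\<forall>x::'k. \<exists>y. y ^ CHAR('k) = x"
    and "of_nat CHAR('k) ^ j * f = 0"
  shows "of_nat CHAR('k) ^ (CARD('n) - j) dvd f"
proof -
  have "of_nat CHAR('k) ^ j * Poly_Mapping.lookup f m = 0" for m
    using arg_cong[OF assms(2), of "\<lambda>f. Poly_Mapping.lookup f m"]
      pol_lookup_of_nat_mult[of "CHAR('k) ^ j" f m] by simp
  then have "of_nat CHAR('k) ^ (CARD('n) - j) dvd Poly_Mapping.lookup f m" for m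
    by (rule witt_p_power_mult_eq_0[OF perfect])
  then show ?thesis using of_nat_dvd_pol_iff[of "CHAR('k) ^ (CARD('n) - j)" f] by simp
qed

text \<open>The reason why the ghost map does not depend on the chosen lifts.\<close>
lemma p_power_mult_power_cong:
  fixes f g :: "('d, ('k::comm_ring_prime_char, 'n::finite) witt) pol"
  assumes "of_nat CHAR('k) dvd f - g" "i < CARD('n)"
  shows "of_nat CHAR('k) ^ i * f ^ (CHAR('k) ^ (CARD('n) - 1 - i))
      = of_nat CHAR('k) ^ i * g ^ (CHAR('k) ^ (CARD('n) - 1 - i))"
proof -
  let ?l = "CARD('n) - 1 - i"
  have "of_nat CHAR('k) ^ i * of_nat CHAR('k) ^ Suc ?l
      dvd of_nat CHAR('k) ^ i * (f ^ (CHAR('k) ^ ?l) - g ^ (CHAR('k) ^ ?l))"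
    by (intro mult_dvd_mono dvd_refl dvd_power_ppow_diff assms)
  moreover have "(of_nat CHAR('k) :: ('d, ('k, 'n) witt) pol) ^ i * of_nat CHAR('k) ^ Suc ?l = 0"
    unfolding power_add[symmetric] by (rule pol_p_power_eq_0) (use assms(2) in simp)
  ultimately show ?thesis by (simp add: right_diff_distrib)
qed

lemma ghost_map_eq:
  fixes x :: "(('d, 'k::comm_ring_prime_char) pol, 'n::finite) witt"
    and f :: "nat \<Rightarrow> ('d, ('k, 'n) witt) pol"
  assumes perfect: "\<forall>x::'k. \<exists>y. y ^ CHAR('k) = x"
    and f: "\<And>i. i < CARD('n) \<Longrightarrow> pol_red (f i) = witt_nth x i"
  shows "ghost_map x = (\<Sum>i<CARD('n). of_nat CHAR('k) ^ i * f i ^ (CHAR('k) ^ (CARD('n) - 1 - i)))"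
  unfolding ghost_map_def
proof (rule sum.cong)
  fix i assume i: "i \<in> {..<CARD('n)}"
  let ?f = "SOME f :: ('d, ('k, 'n) witt) pol. pol_red f = witt_nth x i"
  have "pol_red ?f = witt_nth x i" by (rule someI_ex) (rule pol_red_surj)
  with i f[of i] show "of_nat CHAR('k) ^ i * ?f ^ (CHAR('k) ^ (CARD('n) - 1 - i))
      = of_nat CHAR('k) ^ i * f i ^ (CHAR('k) ^ (CARD('n) - 1 - i))"
    by (intro p_power_mult_power_cong pol_red_eqD[OF perfect]) auto
qed simp

lemma ghost_map_zero:
  assumes perfect: "\<forall>x::'k. \<exists>y. y ^ CHAR('k) = x"
  shows "ghost_map (0 :: (('d, 'k::comm_ring_prime_char) pol, 'n::finite) witt) = 0"
  by (subst ghost_map_eq[OF perfect, of "\<lambda>_. 0"])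
    (use prime_gt_0_nat[OF CHAR_prime[where 'a='k]] in \<open>simp_all add: witt_nth_0_0 power_0_left\<close>)

text \<open>The ghost map has trivial kernel. At the first nonzero component \<open>x\<^sub>i\<close> one can divide the
ghost image by \<open>p\<^sup>i\<close> and reduce modulo \<open>p\<close>, which leaves a power of \<open>x\<^sub>i\<close> in the domain \<open>k[t\<^sub>1, \<dots>,
t\<^sub>d]\<close>.\<close>
lemma ghost_map_eq_0:
  fixes x :: "(('d::{finite,linorder}, 'k::field_prime_char) pol, 'n::finite) witt"
  assumes perfect: "\<forall>x::'k. \<exists>y. y ^ CHAR('k) = x" and "ghost_map x = 0"
  shows "x = 0"
proof -
  let ?p = "CHAR('k)" and ?n = "CARD('n)"
  have "witt_nth x i = 0" if "i < ?n" for i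
    using that
  proof (induction i rule: less_induct)
    case (less i)
    \<comment> \<open>By induction hypothesis, the components before \<open>x\<^sub>i\<close> vanish, so \<open>0\<close> is an admissible lift of them.\<close>
    define f :: "nat \<Rightarrow> ('d, ('k, 'n) witt) pol"
      where "f l = (if l < i then 0 else SOME f. pol_red f = witt_nth x l)" for l
    have "pol_red (SOME f :: ('d, ('k, 'n) witt) pol. pol_red f = witt_nth x l) = witt_nth x l" for l
      by (rule someI_ex) (rule pol_red_surj)
    then have f: "pol_red (f l) = witt_nth x l" if "l < ?n" for l
      using that less by (simp add: f_def)
    let ?t = "\<lambda>l. of_nat ?p ^ l * f l ^ (?p ^ (?n - 1 - l))"
    have "{..<?n} = insert i ({..<i} \<union> {Suc i..<?n})" "{..<i} \<inter> {Suc i..<?n} = {}"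
      using less.prems by auto
    then have "(\<Sum>l<?n. ?t l) = (\<Sum>l<i. ?t l) + ?t i + (\<Sum>l=Suc i..<?n. ?t l)"
      by (simp add: sum.union_disjoint)
    moreover have "(\<Sum>l<i. ?t l) = 0"
      by (rule sum.neutral)
        (use prime_gt_0_nat[OF CHAR_prime[where 'a='k]] in \<open>simp add: f_def power_0_left\<close>)
    moreover have "of_nat ?p ^ Suc i dvd (\<Sum>l=Suc i..<?n. ?t l)"
      by (intro dvd_sum dvd_mult2 le_imp_power_dvd) simp
    then obtain g where "(\<Sum>l=Suc i..<?n. ?t l) = of_nat ?p ^ Suc i * g" by (elim dvdE)
    moreover have "(\<Sum>l<?n. ?t l) = 0"
      using ghost_map_eq[OF perfect, of f x] f assms(2) by simp
    ultimately have "of_nat ?p ^ i * (f i ^ (?p ^ (?n - 1 - i)) + of_nat ?p * g) = 0"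
      by (simp add: distrib_left mult.left_commute mult.assoc)
    then have "of_nat ?p ^ (?n - i) dvd f i ^ (?p ^ (?n - 1 - i)) + of_nat ?p * g"
      by (rule pol_p_power_mult_eq_0[OF perfect])
    moreover have "of_nat ?p dvd (of_nat ?p :: ('d, ('k, 'n) witt) pol) ^ (?n - i)"
      using less.prems by (intro dvd_power) simp
    ultimately have "of_nat ?p dvd f i ^ (?p ^ (?n - 1 - i)) + of_nat ?p * g"
      by (rule dvd_trans[rotated])
    then have "pol_red (f i ^ (?p ^ (?n - 1 - i)) + of_nat ?p * g) = 0"
      by (auto elim!: dvdE simp: pol_red_of_nat_CHAR)
    then have "witt_nth x i ^ (?p ^ (?n - 1 - i)) = 0"
      using f[OF less.prems] by (simp add: pol_red_add pol_red_power pol_red_of_nat_CHAR)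
    then show ?case by simp
  qed
  then show ?thesis by (intro witt_eqI) (simp add: witt_nth_0_0)
qed

section \<open>The image of the ghost map\<close>
lemma prime_power_dvd_choose:
  assumes p: "prime (p :: nat)" and r: "r > 0"
  shows "p ^ (multiplicity p m - multiplicity p r) dvd m choose r"
proof (cases "(m choose r) = 0")
  case False
  have eq: "r * (m choose r) = m * ((m - 1) choose (r - 1))" using r by (rule times_binomial_minus1_eq)
  have "p ^ multiplicity p m dvd r * (m choose r)"
    unfolding eq by (intro dvd_mult2 multiplicity_dvd)
  then have "multiplicity p m \<le> multiplicity p (r * (m choose r))"
    using False r p by (intro multiplicity_geI) (auto simp: not_prime_unit)
  also have "\<dots> = multiplicity p r + multiplicity p (m choose r)"
    using False r p by (intro prime_elem_multiplicity_mult_distrib) auto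
  finally show ?thesis by (intro multiplicity_dvd') simp
qed (simp only: dvd_0_right)

text \<open>The additive group of the polynomials in which the coefficient of each \<open>t\<^sup>m\<close> is divisible by
\<open>p\<^bsup>l - v(m)\<^esup>\<close>, where \<open>v(m)\<close> is the minimum of the valuations of the nonzero \<open>m\<^sub>j\<close>; the minimum is
expressed by requiring divisibility for each \<open>j\<close>. The subtraction is truncated, so there is no
condition when \<open>v(m) \<ge> l\<close>, and none on the constant term. For \<open>l = n\<close> and polynomials over the Witt
vectors of length \<open>n + 1\<close> of a perfect field, this group is the span of the image of the ghost map.\<close>
definition val_bounded :: "nat \<Rightarrow> nat \<Rightarrow> ('d, 'a::comm_ring_1) pol \<Rightarrow> bool"
  where "val_bounded p l f \<longleftrightarrow> (\<forall>m j. Poly_Mapping.lookup m j \<noteq> 0 \<longrightarrow>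
    of_nat p ^ (l - multiplicity p (Poly_Mapping.lookup m j)) dvd Poly_Mapping.lookup f m)"

lemma val_bounded_zero: "val_bounded p l 0"
  by (simp add: val_bounded_def)

lemma val_bounded_add: "val_bounded p l f \<Longrightarrow> val_bounded p l g \<Longrightarrow> val_bounded p l (f + g)"
  by (simp add: val_bounded_def lookup_add dvd_add)

lemma val_bounded_sum: "(\<And>i. i \<in> S \<Longrightarrow> val_bounded p l (f i)) \<Longrightarrow> val_bounded p l (sum f S)"
  by (induction S rule: infinite_finite_induct) (simp_all add: val_bounded_zero val_bounded_add)

lemma val_bounded_of_nat_mult:
  fixes f :: "('d, 'a::comm_ring_1) pol"
  assumes "val_bounded p u f" "p ^ (l - u) dvd c"
  shows "val_bounded p l (of_nat c * f)"
  unfolding val_bounded_def pol_lookup_of_nat_mult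
proof (intro allI impI)
  fix m :: "'d \<Rightarrow>\<^sub>0 nat" and j assume "Poly_Mapping.lookup m j \<noteq> 0"
  let ?v = "multiplicity p (Poly_Mapping.lookup m j)"
  obtain k where "c = p ^ (l - u) * k" using assms(2) by (elim dvdE)
  then have "(of_nat p ^ (l - u) :: 'a) dvd of_nat c" by simp
  moreover have "of_nat p ^ (u - ?v) dvd Poly_Mapping.lookup f m"
    using assms(1) \<open>Poly_Mapping.lookup m j \<noteq> 0\<close> by (simp add: val_bounded_def)
  ultimately have "of_nat p ^ (l - u) * of_nat p ^ (u - ?v) dvd of_nat c * Poly_Mapping.lookup f m"
    by (rule mult_dvd_mono)
  moreover have "(of_nat p :: 'a) ^ (l - ?v) dvd of_nat p ^ (l - u) * of_nat p ^ (u - ?v)"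
    unfolding power_add[symmetric] by (rule le_imp_power_dvd) simp
  ultimately show "of_nat p ^ (l - ?v) dvd of_nat c * Poly_Mapping.lookup f m"
    by (rule dvd_trans[rotated])
qed

lemma single_power:
  assumes "\<And>j. Poly_Mapping.lookup m j = k * Poly_Mapping.lookup s j"
  shows "Poly_Mapping.single s c ^ k = Poly_Mapping.single m (c ^ k :: 'a::comm_ring_1)"
  using assms
proof (induction k arbitrary: m)
  case 0
  then have "m = 0" by (intro poly_mapping_eqI) simp
  then show ?case by simp
next
  case (Suc k)
  have "Poly_Mapping.single s c ^ k = Poly_Mapping.single (m - s) (c ^ k)"
    by (rule Suc.IH) (simp add: lookup_minus Suc.prems)
  moreover have "s + (m - s) = m"
    by (rule poly_mapping_eqI) (simp add: lookup_add lookup_minus Suc.prems)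
  ultimately show ?case by (simp add: mult_single)
qed

text \<open>The terms of \<open>(f + g)\<^bsup>p\<^sup>l\<^esup>\<close> other than the extreme ones are multiples of \<open>(p\<^sup>l choose k)\<close>,
hence of \<open>p\<^bsup>l - u\<^esup>\<close> for \<open>u = v\<^sub>p(k) < l\<close>, times a \<open>p\<^sup>u\<close>-th power, so that induction on \<open>l\<close> applies.\<close>
lemma val_bounded_prime_power:
  fixes f :: "('d, 'a::comm_ring_1) pol"
  assumes p: "prime p"
  shows "val_bounded p l (f ^ (p ^ l))"
proof (induction l arbitrary: f rule: less_induct)
  case (less l)
  show ?case
  proof (induction f rule: pol_induct)
    case (single s c)
    define m where "m = Poly_Mapping.map ((*) (p ^ l)) s"
    have m: "Poly_Mapping.lookup m j = p ^ l * Poly_Mapping.lookup s j" for j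
      by (simp add: m_def Poly_Mapping.map.rep_eq when_def)
    have "l \<le> multiplicity p (Poly_Mapping.lookup m j)" if "Poly_Mapping.lookup m j \<noteq> 0" for j
      using that p by (intro multiplicity_geI) (auto simp: m not_prime_unit)
    then show ?case
      unfolding single_power[of m "p ^ l" s c, OF m]
      by (simp add: val_bounded_def lookup_single when_def)
  next
    case (add f g)
    have t: "val_bounded p l (of_nat (p ^ l choose k) * f ^ k * g ^ (p ^ l - k))"
      if k: "k \<in> {1..<p ^ l}" for k
    proof -
      define u where "u = multiplicity p k"
      have "p ^ u dvd k" by (simp add: u_def multiplicity_dvd)
      then obtain a where a: "k = p ^ u * a" by (elim dvdE)
      have "p ^ u \<le> k" using \<open>p ^ u dvd k\<close> k by (intro dvd_imp_le) auto
      then have "p ^ u < p ^ l" using k by simp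
      then have "u < l" using prime_gt_1_nat[OF p] by simp
      then have "p ^ u dvd p ^ l" by (simp add: le_imp_power_dvd)
      then have "p ^ u dvd p ^ l - k" using \<open>p ^ u dvd k\<close> by (rule dvd_diff_nat)
      then obtain b where b: "p ^ l - k = p ^ u * b" by (elim dvdE)
      have "f ^ k * g ^ (p ^ l - k) = (f ^ a * g ^ b) ^ (p ^ u)"
        unfolding b by (subst a) (simp add: power_mult_distrib power_mult[symmetric] mult.commute)
      moreover have "p ^ (l - u) dvd (p ^ l choose k)"
        using prime_power_dvd_choose[OF p, of k "p ^ l"] k prime_gt_1_nat[OF p]
        by (simp add: u_def multiplicity_same_power)
      ultimately show ?thesis
        unfolding mult.assoc
        using val_bounded_of_nat_mult[OF less.IH[OF \<open>u < l\<close>, of "f ^ a * g ^ b"]] by metis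
    qed
    have "0 < p ^ l" using prime_gt_0_nat[OF p] by simp
    then have "{..p ^ l} = insert 0 (insert (p ^ l) {1..<p ^ l})" by auto
    then have "(f + g) ^ (p ^ l) = g ^ (p ^ l) + (f ^ (p ^ l)
        + (\<Sum>k\<in>{1..<p ^ l}. of_nat (p ^ l choose k) * f ^ k * g ^ (p ^ l - k)))"
      unfolding binomial_ring using \<open>0 < p ^ l\<close> by simp
    then show ?case using add t by (simp only: val_bounded_add val_bounded_sum)
  qed
qed

lemma val_bounded_divided_partial:
  fixes f :: "('d, 'a::comm_ring_1) pol"
  assumes p: "prime p" and f: "val_bounded p l f"
  shows "val_bounded p l (divided_partial j r f)"
  unfolding val_bounded_def lookup_divided_partial
proof (intro allI impI)
  fix m :: "'d \<Rightarrow>\<^sub>0 nat" and i assume i: "Poly_Mapping.lookup m i \<noteq> 0"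
  let ?m = "m + Poly_Mapping.single j r"
  let ?v = "multiplicity p (Poly_Mapping.lookup m i)"
    and ?w = "multiplicity p (Poly_Mapping.lookup ?m i)"
  have "Poly_Mapping.lookup ?m i \<noteq> 0" using i by (simp add: lookup_add)
  then have fm: "of_nat p ^ (l - ?w) dvd Poly_Mapping.lookup f ?m"
    using f unfolding val_bounded_def by blast
  show "of_nat p ^ (l - ?v)
      dvd of_nat ((Poly_Mapping.lookup m j + r) choose r) * Poly_Mapping.lookup f ?m"
  proof (cases "i = j")
    case False
    then have "?w = ?v" by (simp add: lookup_add lookup_single when_def)
    then show ?thesis using fm by (intro dvd_mult) simp
  next
    case True
    \<comment> \<open>Symmetry of the binomial coefficient replaces \<open>v\<^sub>p(r)\<close> by the valuation of the exponent that remains.\<close>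
    have "(Poly_Mapping.lookup m j + r) choose r
        = (Poly_Mapping.lookup ?m i choose Poly_Mapping.lookup m i)"
      using binomial_symmetric[of r "Poly_Mapping.lookup m j + r"] True by (simp add: lookup_add)
    then have "p ^ (?w - ?v) dvd (Poly_Mapping.lookup m j + r) choose r"
      using prime_power_dvd_choose[OF p, of "Poly_Mapping.lookup m i" "Poly_Mapping.lookup ?m i"] i
      by simp
    then obtain k where "(Poly_Mapping.lookup m j + r) choose r = p ^ (?w - ?v) * k" by (elim dvdE)
    then have "of_nat p ^ (?w - ?v) dvd (of_nat ((Poly_Mapping.lookup m j + r) choose r) :: 'a)" by simp
    then have "of_nat p ^ (?w - ?v) * of_nat p ^ (l - ?w) dvd
        of_nat ((Poly_Mapping.lookup m j + r) choose r) * Poly_Mapping.lookup f ?m"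
      using fm by (rule mult_dvd_mono)
    moreover have "(of_nat p :: 'a) ^ (l - ?v) dvd of_nat p ^ (?w - ?v) * of_nat p ^ (l - ?w)"
      unfolding power_add[symmetric] by (rule le_imp_power_dvd) simp
    ultimately show ?thesis by (rule dvd_trans[rotated])
  qed
qed

lemma multi_index_root:
  assumes "\<And>j. k dvd Poly_Mapping.lookup r j"
  obtains s where "\<And>j. Poly_Mapping.lookup r j = k * Poly_Mapping.lookup (s :: 'd \<Rightarrow>\<^sub>0 nat) j"
proof (rule that)
  fix j show "Poly_Mapping.lookup r j = k * Poly_Mapping.lookup (Poly_Mapping.map (\<lambda>x. x div k) r) j"
    using assms[of j] by (simp add: Poly_Mapping.map.rep_eq when_def)
qed

lemma multi_index_min:
  fixes r :: "'d \<Rightarrow>\<^sub>0 nat"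
  assumes "r \<noteq> 0"
  obtains j where "Poly_Mapping.lookup r j \<noteq> 0"
    "multi_val p r = enat (multiplicity p (Poly_Mapping.lookup r j))"
    "\<And>i. p ^ multiplicity p (Poly_Mapping.lookup r j) dvd Poly_Mapping.lookup r i"
proof -
  let ?v = "\<lambda>j. multiplicity p (Poly_Mapping.lookup r j)"
  have "Poly_Mapping.keys r \<noteq> {}" using assms by simp
  then obtain k where "k \<in> Poly_Mapping.keys r" by blast
  then have "multi_val p r \<in> (\<lambda>j. enat (?v j)) ` Poly_Mapping.keys r"
    unfolding multi_val_def by (intro wellorder_InfI[of "enat (?v k)"]) auto
  then obtain j where j: "j \<in> Poly_Mapping.keys r" "multi_val p r = enat (?v j)" by blast
  have "p ^ ?v j dvd Poly_Mapping.lookup r i" for i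
  proof (cases "i \<in> Poly_Mapping.keys r")
    case True
    then have "multi_val p r \<le> enat (?v i)" unfolding multi_val_def by (rule INF_lower)
    then show ?thesis using j by (intro multiplicity_dvd') simp
  qed (simp add: in_keys_iff)
  then show ?thesis using that[of j] j by (simp add: in_keys_iff)
qed

lemma ghost_map_val_bounded:
  "val_bounded CHAR('k) (CARD('n) - 1)
    (ghost_map (x :: (('d, 'k::comm_ring_prime_char) pol, 'n::finite) witt))"
  unfolding ghost_map_def
proof (rule val_bounded_sum)
  fix i assume "i \<in> {..<CARD('n)}"
  then have "val_bounded CHAR('k) (CARD('n) - 1)
      (of_nat (CHAR('k) ^ i) * f ^ (CHAR('k) ^ (CARD('n) - 1 - i)))" for f :: "('d, ('k, 'n) witt) pol"
    by (intro val_bounded_of_nat_mult[OF val_bounded_prime_power]) auto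
  then show "val_bounded CHAR('k) (CARD('n) - 1)
     (of_nat CHAR('k) ^ i * (SOME f :: ('d, ('k, 'n) witt) pol. pol_red f = witt_nth x i)
       ^ (CHAR('k) ^ (CARD('n) - 1 - i)))"
    by simp
qed

lemma ghost_map_monomial:
  fixes r :: "'d \<Rightarrow>\<^sub>0 nat"
  assumes perfect: "\<forall>x::'k. \<exists>y. y ^ CHAR('k) = x"
    and dvd: "\<And>j. CHAR('k) ^ e dvd Poly_Mapping.lookup r j" and e: "e < CARD('n)"
  shows "\<exists>x :: (('d, 'k::comm_ring_prime_char) pol, 'n::finite) witt.
    ghost_map x = of_nat CHAR('k) ^ (CARD('n) - 1 - e) * Poly_Mapping.single r 1"
proof -
  let ?i = "CARD('n) - 1 - e"
  obtain s where s: "\<And>j. Poly_Mapping.lookup r j = CHAR('k) ^ e * Poly_Mapping.lookup s j"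
    using multi_index_root[of "CHAR('k) ^ e" r] dvd by blast
  define f :: "nat \<Rightarrow> ('d, ('k, 'n) witt) pol"
    where "f l = (if l = ?i then Poly_Mapping.single s 1 else 0)" for l
  have "ghost_map (to_witt (\<lambda>l. pol_red (f l)) :: (('d, 'k) pol, 'n) witt)
      = (\<Sum>l<CARD('n). of_nat CHAR('k) ^ l * f l ^ (CHAR('k) ^ (CARD('n) - 1 - l)))"
    by (rule ghost_map_eq[OF perfect]) (simp add: witt_nth_to_witt)
  also have "\<dots> = of_nat CHAR('k) ^ ?i * f ?i ^ (CHAR('k) ^ (CARD('n) - 1 - ?i))"
  proof (rule sum.remove[THEN trans])
    show "?i \<in> {..<CARD('n)}" using e by auto
    have "(\<Sum>l\<in>{..<CARD('n)} - {?i}. of_nat CHAR('k) ^ l * f l ^ (CHAR('k) ^ (CARD('n) - 1 - l))) = 0"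
      by (rule sum.neutral)
        (use prime_gt_0_nat[OF CHAR_prime[where 'a='k]] in \<open>auto simp: f_def power_0_left\<close>)
    then show "of_nat CHAR('k) ^ ?i * f ?i ^ (CHAR('k) ^ (CARD('n) - 1 - ?i))
      + (\<Sum>l\<in>{..<CARD('n)} - {?i}. of_nat CHAR('k) ^ l * f l ^ (CHAR('k) ^ (CARD('n) - 1 - l)))
      = of_nat CHAR('k) ^ ?i * f ?i ^ (CHAR('k) ^ (CARD('n) - 1 - ?i))" by simp
  qed simp
  also have "CARD('n) - 1 - ?i = e" using e by simp
  also have "f ?i ^ (CHAR('k) ^ e) = Poly_Mapping.single r 1"
    using single_power[OF s, where c = "1 :: ('k, 'n) witt"] by (simp add: f_def)
  finally show ?thesis by blast
qed

section \<open>Uniqueness of divided power lifts on the image of the ghost map\<close>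
lemma fps_of_nat_dvd_iff:
  "of_nat c dvd (F :: 'a::comm_ring_1 fps) \<longleftrightarrow> (\<forall>i. of_nat c dvd fps_nth F i)"
proof
  assume "of_nat c dvd F"
  then show "\<forall>i. of_nat c dvd fps_nth F i" by (auto elim!: dvdE simp flip: fps_of_nat)
next
  assume "\<forall>i. of_nat c dvd fps_nth F i"
  then have "\<forall>i. \<exists>k. fps_nth F i = of_nat c * k" by (simp add: dvd_def)
  from choice[OF this] obtain k where "\<forall>i. fps_nth F i = of_nat c * k i" by (rule exE)
  then have "F = of_nat c * Abs_fps k" by (intro fps_ext) (simp flip: fps_of_nat)
  then show "of_nat c dvd F" by simp
qed

text \<open>A Hasse-Schmidt derivation \<open>E\<close> of length \<open>r\<close> is multiplicative as the map \<open>f \<mapsto> \<Sum>\<^bsub>i\<le>r\<^esub> E\<^sub>i(f)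
T\<^sup>i\<close> modulo \<open>T\<^bsup>r+1\<^esup>\<close>. The exponent \<open>k\<close> is positive because nothing is assumed about the values
\<open>E\<^sub>i(1)\<close>.\<close>
lemma Leibniz_fps_power:
  fixes E :: "nat \<Rightarrow> 'a::comm_ring_1 \<Rightarrow> 'a"
  assumes leibniz: "\<And>i f g. i \<le> r \<Longrightarrow> E i (f * g) = (\<Sum>a\<le>i. E a f * E (i - a) g)"
    and "i \<le> r" "k > 0"
  shows "E i (f ^ k) = fps_nth (Abs_fps (\<lambda>i. if i \<le> r then E i f else 0) ^ k) i"
  using \<open>k > 0\<close> \<open>i \<le> r\<close>
proof (induction k arbitrary: i rule: nat_induct_non_zero)
  case (Suc k)
  have "E i (f ^ Suc k) = (\<Sum>a\<le>i. E a f * E (i - a) (f ^ k))" using leibniz Suc.prems by simp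
  also have "\<dots> = (\<Sum>a\<le>i. fps_nth (Abs_fps (\<lambda>i. if i \<le> r then E i f else 0)) a
      * fps_nth (Abs_fps (\<lambda>i. if i \<le> r then E i f else 0) ^ k) (i - a))"
    by (rule sum.cong) (use Suc in auto)
  finally show ?case by (simp add: fps_mult_nth atLeast0AtMost)
qed simp

lemma pol_diff_ops_linear: "\<delta> \<in> pol_diff_ops \<Longrightarrow> alg_linear const_pol \<delta>"
  by (auto simp: pol_diff_ops_def diff_ops_def intro: diff_ops_le_linear)

lemma alg_linear_of_nat_mult: "alg_linear \<rho> \<delta> \<Longrightarrow> \<delta> (of_nat c * x) = of_nat c * \<delta> x"
  by (induction c) (simp_all add: alg_linear_zero alg_linear_add distrib_right)

lemma alg_linear_sum: "alg_linear \<rho> \<delta> \<Longrightarrow> \<delta> (sum f S) = (\<Sum>i\<in>S. \<delta> (f i))"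
  by (induction S rule: infinite_finite_induct) (simp_all add: alg_linear_zero alg_linear_add)

lemma is_divided_lift_linear: "is_divided_lift j r \<delta> \<Longrightarrow> alg_linear const_pol \<delta>"
  unfolding is_divided_lift_def is_lift_def using pol_diff_ops_linear by blast

text \<open>Two lifts yield truncated power series that are congruent modulo \<open>p\<close>; their \<open>p\<^sup>l\<close>-th powers
are congruent modulo \<open>p\<^bsup>l+1\<^esup>\<close>, and for \<open>l = n - i\<close> a further factor \<open>p\<^sup>i\<close> removes the difference, as
\<open>p\<^bsup>n+1\<^esup> = 0\<close>.\<close>
lemma is_divided_lift_power_unique:
  fixes \<delta> \<delta>' :: "('d, ('k::comm_ring_prime_char, 'n::finite) witt) pol \<Rightarrow> ('d, ('k, 'n) witt) pol"
  assumes perfect: "\<forall>x::'k. \<exists>y. y ^ CHAR('k) = x"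
    and \<delta>: "is_divided_lift j r \<delta>" and \<delta>': "is_divided_lift j r \<delta>'" and i: "i < CARD('n)"
  shows "\<delta> (of_nat CHAR('k) ^ i * f ^ (CHAR('k) ^ (CARD('n) - 1 - i)))
    = \<delta>' (of_nat CHAR('k) ^ i * f ^ (CHAR('k) ^ (CARD('n) - 1 - i)))"
proof -
  let ?p = "CHAR('k)" and ?l = "CARD('n) - 1 - i"
  obtain E where E0: "E r = \<delta> \<and> E 0 = id \<and> (\<forall>i\<le>r. is_lift (E i) (divided_partial j i) \<and>
      (\<forall>f g. E i (f * g) = (\<Sum>a\<le>i. E a f * E (i - a) g)))"
    using \<delta> unfolding is_divided_lift_def by (rule exE)
  then have E: "E r = \<delta>" "\<And>i. i \<le> r \<Longrightarrow> is_lift (E i) (divided_partial j i)"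
    "\<And>i f g. i \<le> r \<Longrightarrow> E i (f * g) = (\<Sum>a\<le>i. E a f * E (i - a) g)"
    by simp_all
  obtain E' where E'0: "E' r = \<delta>' \<and> E' 0 = id \<and> (\<forall>i\<le>r. is_lift (E' i) (divided_partial j i) \<and>
      (\<forall>f g. E' i (f * g) = (\<Sum>a\<le>i. E' a f * E' (i - a) g)))"
    using \<delta>' unfolding is_divided_lift_def by (rule exE)
  then have E': "E' r = \<delta>'" "\<And>i. i \<le> r \<Longrightarrow> is_lift (E' i) (divided_partial j i)"
    "\<And>i f g. i \<le> r \<Longrightarrow> E' i (f * g) = (\<Sum>a\<le>i. E' a f * E' (i - a) g)"
    by simp_all
  define F where "F = Abs_fps (\<lambda>i. if i \<le> r then E i f else 0)"
  define F' where "F' = Abs_fps (\<lambda>i. if i \<le> r then E' i f else 0)"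
  have "of_nat ?p dvd E i f - E' i f" if "i \<le> r" for i
    by (rule pol_red_eqD[OF perfect]) (use E(2)[OF that] E'(2)[OF that] in \<open>simp add: is_lift_def\<close>)
  then have "of_nat ?p dvd F - F'" unfolding fps_of_nat_dvd_iff F_def F'_def by auto
  then have "of_nat (?p ^ Suc ?l) dvd F ^ (?p ^ ?l) - F' ^ (?p ^ ?l)"
    unfolding of_nat_power by (rule dvd_power_ppow_diff)
  then have "of_nat (?p ^ Suc ?l) dvd fps_nth (F ^ (?p ^ ?l) - F' ^ (?p ^ ?l)) r"
    unfolding fps_of_nat_dvd_iff by blast
  moreover have k: "?p ^ ?l > 0" using prime_gt_0_nat[OF CHAR_prime[where 'a='k]] by simp
  have "\<delta> (f ^ (?p ^ ?l)) = fps_nth (F ^ (?p ^ ?l)) r"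
    unfolding F_def E(1)[symmetric] by (rule Leibniz_fps_power[OF E(3) order.refl k])
  moreover have "\<delta>' (f ^ (?p ^ ?l)) = fps_nth (F' ^ (?p ^ ?l)) r"
    unfolding F'_def E'(1)[symmetric] by (rule Leibniz_fps_power[OF E'(3) order.refl k])
  ultimately have "of_nat ?p ^ Suc ?l dvd \<delta> (f ^ (?p ^ ?l)) - \<delta>' (f ^ (?p ^ ?l))"
    by (simp only: fps_sub_nth of_nat_power)
  then have "of_nat ?p ^ i * of_nat ?p ^ Suc ?l
      dvd of_nat ?p ^ i * (\<delta> (f ^ (?p ^ ?l)) - \<delta>' (f ^ (?p ^ ?l)))"
    by (rule mult_dvd_mono[OF dvd_refl])
  moreover have "(of_nat ?p :: ('d, ('k, 'n) witt) pol) ^ i * of_nat ?p ^ Suc ?l = 0"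
    unfolding power_add[symmetric] by (rule pol_p_power_eq_0) (use i in simp)
  ultimately have "of_nat (?p ^ i) * \<delta> (f ^ (?p ^ ?l)) = of_nat (?p ^ i) * \<delta>' (f ^ (?p ^ ?l))"
    by (simp only: right_diff_distrib dvd_0_left_iff right_minus_eq of_nat_power)
  then show ?thesis
    using alg_linear_of_nat_mult[OF is_divided_lift_linear[OF \<delta>], of "?p ^ i" "f ^ (?p ^ ?l)"]
      alg_linear_of_nat_mult[OF is_divided_lift_linear[OF \<delta>'], of "?p ^ i" "f ^ (?p ^ ?l)"]
    by (simp only: of_nat_power)
qed

lemma val_bounded_monomial:
  fixes f :: "('d, 'a::comm_ring_1) pol"
  assumes f: "val_bounded p l f"
  shows "\<exists>i c s. i \<le> l \<and> Poly_Mapping.single m (Poly_Mapping.lookup f m)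
    = const_pol c * (of_nat p ^ i * Poly_Mapping.single s 1 ^ (p ^ (l - i)))"
proof -
  have "\<exists>i\<le>l. of_nat p ^ i dvd Poly_Mapping.lookup f m \<and> (\<forall>j. p ^ (l - i) dvd Poly_Mapping.lookup m j)"
  proof (cases "m = 0")
    case False
    then obtain j where j: "Poly_Mapping.lookup m j \<noteq> 0"
      "\<And>i. p ^ multiplicity p (Poly_Mapping.lookup m j) dvd Poly_Mapping.lookup m i"
      using multi_index_min[OF False, of p] by blast
    let ?v = "multiplicity p (Poly_Mapping.lookup m j)"
    have "of_nat p ^ (l - ?v) dvd Poly_Mapping.lookup f m" using f j(1) by (simp add: val_bounded_def)
    moreover have "p ^ (l - (l - ?v)) dvd Poly_Mapping.lookup m i" for i
      by (rule dvd_trans[OF le_imp_power_dvd j(2)]) simp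
    ultimately show ?thesis by (intro exI[of _ "l - ?v"]) simp
  qed (auto intro!: exI[of _ 0])
  then obtain i c where i: "i \<le> l" "Poly_Mapping.lookup f m = of_nat p ^ i * c"
    "\<And>j. p ^ (l - i) dvd Poly_Mapping.lookup m j" by (auto elim!: dvdE)
  obtain s where "\<And>j. Poly_Mapping.lookup m j = p ^ (l - i) * Poly_Mapping.lookup s j"
    using multi_index_root i(3) by blast
  then have "Poly_Mapping.single s 1 ^ (p ^ (l - i)) = Poly_Mapping.single m (1 :: 'a)"
    using single_power[of m "p ^ (l - i)" s 1] by simp
  then have "Poly_Mapping.single m (Poly_Mapping.lookup f m)
      = const_pol c * (of_nat p ^ i * Poly_Mapping.single s 1 ^ (p ^ (l - i)))"
    using of_nat_mult_single[of "p ^ i" m "1 :: 'a"]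
    by (simp add: i(2) const_pol_mult_single mult.commute)
  then show ?thesis using i(1) by blast
qed

lemma is_divided_lift_unique:
  fixes \<delta> \<delta>' :: "('d, ('k::comm_ring_prime_char, 'n::finite) witt) pol \<Rightarrow> ('d, ('k, 'n) witt) pol"
  assumes perfect: "\<forall>x::'k. \<exists>y. y ^ CHAR('k) = x"
    and \<delta>: "is_divided_lift j r \<delta>" and \<delta>': "is_divided_lift j r \<delta>'"
    and f: "val_bounded CHAR('k) (CARD('n) - 1) f"
  shows "\<delta> f = \<delta>' f"
proof -
  note lin = is_divided_lift_linear[OF \<delta>] is_divided_lift_linear[OF \<delta>']
  have "\<delta> (Poly_Mapping.single m (Poly_Mapping.lookup f m))
      = \<delta>' (Poly_Mapping.single m (Poly_Mapping.lookup f m))" for m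
  proof -
    obtain i c s where i: "i \<le> CARD('n) - 1" and eq: "Poly_Mapping.single m (Poly_Mapping.lookup f m)
        = const_pol c
          * (of_nat CHAR('k) ^ i * Poly_Mapping.single s 1 ^ (CHAR('k) ^ (CARD('n) - 1 - i)))"
      using val_bounded_monomial[OF f] by blast
    have "i < CARD('n)" using i zero_less_card_finite[where 'a='n] by linarith
    from is_divided_lift_power_unique[OF perfect \<delta> \<delta>' this] show ?thesis
      using lin unfolding eq alg_linear_def by simp
  qed
  then show ?thesis
    by (subst (1 2) poly_mapping_sum_singles[of f])
      (simp only: alg_linear_sum[OF lin(1)] alg_linear_sum[OF lin(2)])
qed

lemma divided_partial_is_divided_lift:
  "is_divided_lift j r
    (divided_partial j r :: ('d, ('k::comm_ring_prime_char, 'n::finite) witt) pol \<Rightarrow> ('d,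
        ('k, 'n) witt) pol)"
  unfolding is_divided_lift_def
proof (intro exI[of _ "divided_partial j"] conjI allI impI)
  fix i
  show "is_lift (divided_partial j i :: ('d, ('k, 'n) witt) pol \<Rightarrow> ('d, ('k, 'n) witt) pol)
      (divided_partial j i)"
    using divided_partial_in_diff_ops_le[of j i]
    by (auto simp: is_lift_def pol_diff_ops_def diff_ops_def pol_red_divided_partial)
qed (simp_all add: divided_partial_0_order divided_partial_mult)

text \<open>Since the standard operators preserve the condition on the coefficients, uniqueness passes to
products of lifts.\<close>
lemma multi_op_divided_lift:
  fixes D :: "'d::{finite,linorder} \<Rightarrow> nat
    \<Rightarrow> ('d, ('k::comm_ring_prime_char, 'n::finite) witt) pol \<Rightarrow> ('d, ('k, 'n) witt) pol"
  assumes perfect: "\<forall>x::'k. \<exists>y. y ^ CHAR('k) = x"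
    and D: "\<forall>j r. is_divided_lift j r (D j r)"
    and f: "val_bounded CHAR('k) (CARD('n) - 1) f"
  shows "multi_op D r f = multi_op divided_partial r f"
proof -
  let ?F = "\<lambda>D js. foldr (\<lambda>j g. D j (Poly_Mapping.lookup r j) \<circ> g) js id"
  have F: "?F D (j # js) f = D j (Poly_Mapping.lookup r j) (?F D js f)" for D j js by simp
  have "?F D js f = ?F divided_partial js f
      \<and> val_bounded CHAR('k) (CARD('n) - 1) (?F divided_partial js f)" for js
  proof (induction js)
    case (Cons j js)
    then have "D j (Poly_Mapping.lookup r j) (?F divided_partial js f)
        = divided_partial j (Poly_Mapping.lookup r j) (?F divided_partial js f)"
      using is_divided_lift_unique[OF perfect D[rule_format] divided_partial_is_divided_lift] by blast
    with Cons show ?case unfolding F by (simp only: val_bounded_divided_partial[OF CHAR_prime])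
  qed (use f in simp)
  then show ?thesis by (simp add: multi_op_def)
qed

lemma is_restriction_op_sum_divided_lift:
  fixes D :: "'d::{finite,linorder} \<Rightarrow> nat
    \<Rightarrow> ('d, ('k::comm_ring_prime_char, 'n::finite) witt) pol \<Rightarrow> ('d, ('k, 'n) witt) pol"
  assumes perfect: "\<forall>x::'k. \<exists>y. y ^ CHAR('k) = x"
    and D: "\<forall>j r. is_divided_lift j r (D j r)"
  shows "is_restriction (op_sum c D) R \<longleftrightarrow> is_restriction (op_sum c divided_partial) R"
proof -
  have "op_sum c D (ghost_map x) = op_sum c divided_partial (ghost_map x)" for x
    by (simp only: op_sum_def multi_op_divided_lift[OF perfect D ghost_map_val_bounded])
  then show ?thesis by (simp only: is_restriction_def)
qed

lemma op_sum_is_lift: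
  fixes c :: "('d::{finite,linorder} \<Rightarrow>\<^sub>0 nat) \<Rightarrow> ('d, ('k::comm_ring_prime_char, 'n::finite) witt) pol"
  assumes "finite {r. c r \<noteq> 0}"
  shows "is_lift (op_sum c divided_partial) (op_sum (\<lambda>r. pol_red (c r)) divided_partial)"
  unfolding is_lift_def
proof
  obtain m where "\<And>r. r \<in> mdeg ` {r. c r \<noteq> 0} \<Longrightarrow> r \<le> m"
    using finite_nat_set_iff_bounded_le[of "mdeg ` {r. c r \<noteq> 0}"] assms by auto
  then have "op_sum c divided_partial \<in> diff_ops_le const_pol m"
    by (intro op_sum_in_diff_ops_le) auto
  then show "op_sum c divided_partial \<in> pol_diff_ops" by (auto simp: pol_diff_ops_def diff_ops_def)
  show "\<forall>f. pol_red (op_sum c divided_partial f)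
      = op_sum (\<lambda>r. pol_red (c r)) divided_partial (pol_red f)"
  proof
    fix f :: "('d, ('k, 'n) witt) pol"
    have "op_sum (\<lambda>r. pol_red (c r)) divided_partial (pol_red f)
        = (\<Sum>r | c r \<noteq> 0. pol_red (c r) * multi_op divided_partial r (pol_red f))"
      by (rule op_sum_superset[OF assms]) auto
    then show "pol_red (op_sum c divided_partial f)
        = op_sum (\<lambda>r. pol_red (c r)) divided_partial (pol_red f)"
      by (simp add: op_sum_def pol_red_sum pol_red_mult pol_red_multi_op)
  qed
qed

text \<open>It suffices to lift the coefficients. A zero coefficient is lifted to zero, to keep the sum
finite.\<close>
lemma ex_divided_lift:
  fixes \<theta> :: "('d::{finite,linorder}, 'k::comm_ring_prime_char) pol \<Rightarrow> ('d, 'k) pol"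
  assumes "\<theta> \<in> pol_diff_ops"
  shows "\<exists>(c :: ('d \<Rightarrow>\<^sub>0 nat) \<Rightarrow> ('d, ('k, 'n::finite) witt) pol).
    finite {r. c r \<noteq> 0} \<and> is_lift (op_sum c divided_partial) \<theta>"
proof -
  obtain b where b: "finite {r. b r \<noteq> 0}" "\<theta> = op_sum b divided_partial"
    using pol_diff_ops_eq_op_sum[OF assms] .
  have "\<exists>c :: ('d, ('k, 'n) witt) pol. pol_red c = b r \<and> (b r = 0 \<longrightarrow> c = 0)" for r
    using pol_red_surj[of "b r"] pol_red_zero by metis
  then obtain c :: "('d \<Rightarrow>\<^sub>0 nat) \<Rightarrow> ('d, ('k, 'n) witt) pol"
    where c: "\<And>r. pol_red (c r) = b r" "\<And>r. b r = 0 \<Longrightarrow> c r = 0" by metis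
  have "finite {r. c r \<noteq> 0}" by (rule finite_subset[OF _ b(1)]) (use c(2) in auto)
  then show ?thesis using op_sum_is_lift[of c] b(2) c(1) by auto
qed

section \<open>Operators vanishing on the image of the ghost map\<close>
lemma multi_op_divided_partial_zero [simp]: "multi_op divided_partial r 0 = 0"
  using multi_op_divided_partial_add[of r 0 0] by simp

lemma multi_op_divided_partial_sum:
  "multi_op divided_partial r (sum f S) = (\<Sum>i\<in>S. multi_op divided_partial r (f i))"
  by (induction S rule: infinite_finite_induct) (simp_all add: multi_op_divided_partial_add)

text \<open>On \<open>t\<^sup>m\<close> the factors contribute \<open>p\<^bsup>v(r)+1\<^esup>\<close> from \<open>a\<close>, \<open>p\<^bsup>v(m)-v(r)\<^esup>\<close> from the binomial
coefficients and \<open>p\<^bsup>n-v(m)\<^esup>\<close> from the coefficient of \<open>f\<close>, in total \<open>p\<^bsup>n+1\<^esup> = 0\<close>. The valuations are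
those of the \<open>j\<close>-th exponents, for an index \<open>j\<close> at which \<open>v(r)\<close> is attained.\<close>
lemma mult_multi_op_val_bounded_eq_0:
  fixes f :: "('d::{finite,linorder}, ('k::comm_ring_prime_char, 'n::finite) witt) pol"
  assumes a: "a \<in> ppow_ideal CHAR('k) (multi_val CHAR('k) r + 1)"
    and f: "val_bounded CHAR('k) (CARD('n) - 1) f"
  shows "a * multi_op divided_partial r f = 0"
proof (cases "r = 0")
  case True
  then have "a = 0" using a by (simp add: multi_val_def ppow_ideal_def top_enat_def)
  then show ?thesis by simp
next
  case False
  let ?p = "CHAR('k)"
  obtain j where j: "Poly_Mapping.lookup r j \<noteq> 0"
    "multi_val ?p r = enat (multiplicity ?p (Poly_Mapping.lookup r j))"
    using multi_index_min[OF False, of ?p] by blast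
  define v where "v = multiplicity ?p (Poly_Mapping.lookup r j)"
  have "multi_val ?p r + 1 = enat (Suc v)" by (simp add: j(2) v_def one_enat_def)
  then obtain b where b: "a = of_nat ?p ^ Suc v * b" using a by (auto simp: ppow_ideal_def elim!: dvdE)
  have "a * multi_op divided_partial r (Poly_Mapping.single m (Poly_Mapping.lookup f m)) = 0" for m
  proof -
    define w where "w = multiplicity ?p (Poly_Mapping.lookup m j)"
    have "of_nat ?p ^ (CARD('n) - Suc v) dvd of_nat (mbinom m r) * Poly_Mapping.lookup f m"
    proof (cases "Poly_Mapping.lookup m j = 0")
      case True
      then have "mbinom m r = 0" using j(1) by (auto simp: mbinom_def intro!: exI[of _ j])
      then show ?thesis by simp
    next
      case False
      then have "of_nat ?p ^ (CARD('n) - 1 - w) dvd Poly_Mapping.lookup f m"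
        using f by (simp add: val_bounded_def w_def)
      moreover have "?p ^ (w - v) dvd (Poly_Mapping.lookup m j choose Poly_Mapping.lookup r j)"
        unfolding w_def v_def by (rule prime_power_dvd_choose) (use j(1) in auto)
      then have "?p ^ (w - v) dvd mbinom m r"
        unfolding mbinom_def by (rule dvd_trans) (rule dvd_prodI, auto)
      then obtain k where "mbinom m r = ?p ^ (w - v) * k" by (elim dvdE)
      then have "of_nat ?p ^ (w - v) dvd (of_nat (mbinom m r) :: ('k, 'n) witt)" by simp
      ultimately have "of_nat ?p ^ (w - v) * of_nat ?p ^ (CARD('n) - 1 - w)
          dvd of_nat (mbinom m r) * Poly_Mapping.lookup f m"
        by (intro mult_dvd_mono)
      moreover have "(of_nat ?p :: ('k, 'n) witt) ^ (CARD('n) - Suc v)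
          dvd of_nat ?p ^ (w - v) * of_nat ?p ^ (CARD('n) - 1 - w)"
        unfolding power_add[symmetric] by (rule le_imp_power_dvd) simp
      ultimately show ?thesis by (rule dvd_trans[rotated])
    qed
    then have "of_nat ?p ^ Suc v * of_nat ?p ^ (CARD('n) - Suc v)
        dvd of_nat ?p ^ Suc v * (of_nat (mbinom m r) * Poly_Mapping.lookup f m)"
      by (rule mult_dvd_mono[OF dvd_refl])
    then have "of_nat (?p ^ Suc v) * (of_nat (mbinom m r) * Poly_Mapping.lookup f m) = 0"
      unfolding power_add[symmetric] of_nat_power by (rule witt_p_power_dvd_eq_0[rotated]) simp
    then have "of_nat (?p ^ Suc v)
        * multi_op divided_partial r (Poly_Mapping.single m (Poly_Mapping.lookup f m)) = 0"
      unfolding multi_op_divided_partial_single of_nat_mult_single by (simp only: single_zero)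
    then show ?thesis
      by (simp only: b of_nat_power mult.assoc mult.left_commute[of _ b] mult_zero_right)
  qed
  then show ?thesis
    by (subst poly_mapping_sum_singles[of f])
      (simp only: multi_op_divided_partial_sum sum_distrib_left sum.neutral_const)
qed

text \<open>For the forward direction, induction on the degree of \<open>r\<close> leaves only the term \<open>a\<^sub>r\<close> when the
operator is applied to \<open>p\<^bsup>n-e\<^esup> t\<^sup>r\<close>, where \<open>e = min v(r) n\<close>: lower terms vanish by the induction
hypothesis, the others because their binomial coefficient is zero.\<close>
lemma op_sum_annihilates_ghost_iff:
  fixes a :: "('d::{finite,linorder} \<Rightarrow>\<^sub>0 nat) \<Rightarrow> ('d, ('k::field_prime_char, 'n::finite) witt) pol"
  assumes perfect: "\<forall>x::'k. \<exists>y. y ^ CHAR('k) = x" and fin: "finite {r. a r \<noteq> 0}"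
  shows "(\<forall>x. op_sum a divided_partial (ghost_map x) = 0)
    \<longleftrightarrow> (\<forall>r. a r \<in> ppow_ideal CHAR('k) (multi_val CHAR('k) r + 1))"
proof
  assume "\<forall>r. a r \<in> ppow_ideal CHAR('k) (multi_val CHAR('k) r + 1)"
  then have "a r * multi_op divided_partial r (ghost_map x) = 0" for r x
    using mult_multi_op_val_bounded_eq_0 ghost_map_val_bounded by blast
  then show "\<forall>x. op_sum a divided_partial (ghost_map x) = 0" by (simp add: op_sum_def)
next
  let ?p = "CHAR('k)" and ?n = "CARD('n) - 1"
  assume zero: "\<forall>x. op_sum a divided_partial (ghost_map x) = 0"
  have N: "CARD('n) = Suc ?n" using zero_less_card_finite[where 'a='n] by simp
  show "\<forall>r. a r \<in> ppow_ideal ?p (multi_val ?p r + 1)"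
  proof
    fix r
    show "a r \<in> ppow_ideal ?p (multi_val ?p r + 1)"
    proof (induction "mdeg r" arbitrary: r rule: less_induct)
      case less
      have key: "of_nat ?p ^ Suc e dvd a r" if e: "e \<le> ?n" "\<And>j. ?p ^ e dvd Poly_Mapping.lookup r j"
        for e
      proof -
        obtain x :: "(('d, 'k) pol, 'n) witt"
          where x: "ghost_map x = of_nat ?p ^ (?n - e) * Poly_Mapping.single r 1"
          using ghost_map_monomial[OF perfect e(2), where 'n='n] e(1) N by (metis less_Suc_eq_le)
        let ?t = "\<lambda>s. a s * multi_op divided_partial s (ghost_map x)"
        have gx: "ghost_map x = Poly_Mapping.single r (of_nat (?p ^ (?n - e)))"
          using x of_nat_mult_single[of "?p ^ (?n - e)" r "1 :: ('k, 'n) witt"] by simp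
        have other: "?t s = 0" if "s \<noteq> r" for s
        proof (cases "mdeg s < mdeg r")
          case True
          show ?thesis by (rule mult_multi_op_val_bounded_eq_0[OF less[OF True] ghost_map_val_bounded])
        next
          case False
          then have "mbinom r s = 0" using that by (intro mbinom_eq_0) auto
          then show ?thesis by (simp add: gx multi_op_divided_partial_single)
        qed
        have "op_sum a divided_partial (ghost_map x) = (\<Sum>s\<in>insert r {s. a s \<noteq> 0}. ?t s)"
          by (rule op_sum_superset) (use fin in auto)
        also have "\<dots> = ?t r + (\<Sum>s\<in>insert r {s. a s \<noteq> 0} - {r}. ?t s)"
          by (rule sum.remove) (use fin in auto)
        also have "(\<Sum>s\<in>insert r {s. a s \<noteq> 0} - {r}. ?t s) = 0"
          by (rule sum.neutral) (use other in auto)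
        finally have "?t r = 0" using zero by (simp only: add_0_right)
        then have "a r * Poly_Mapping.single 0 (of_nat (?p ^ (?n - e))) = 0"
          by (simp add: gx multi_op_divided_partial_single)
        then have "a r * of_nat (?p ^ (?n - e)) = 0" by (simp only: single_of_nat)
        then have "of_nat ?p ^ (?n - e) * a r = 0" by (simp only: of_nat_power mult.commute)
        then have "of_nat ?p ^ (CARD('n) - (?n - e)) dvd a r"
          by (rule pol_p_power_mult_eq_0[OF perfect])
        moreover have "CARD('n) - (?n - e) = Suc e" using e(1) N by linarith
        ultimately show ?thesis by simp
      qed
      show ?case
      proof (cases "r = 0")
        case True
        then have "of_nat ?p ^ CARD('n) dvd a r" using key[of ?n] N by simp
        then have "a r = 0" by (simp add: pol_p_power_eq_0)
        then show ?thesis by (simp add: ppow_ideal_def split: enat.split)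
      next
        case False
        obtain j where j: "multi_val ?p r = enat (multiplicity ?p (Poly_Mapping.lookup r j))"
          "\<And>i. ?p ^ multiplicity ?p (Poly_Mapping.lookup r j) dvd Poly_Mapping.lookup r i"
          using multi_index_min[OF False, of ?p] by blast
        define v where "v = multiplicity ?p (Poly_Mapping.lookup r j)"
        define e where "e = min v ?n"
        have "?p ^ e dvd Poly_Mapping.lookup r i" for i
          by (rule dvd_trans[OF le_imp_power_dvd j(2)]) (simp add: e_def v_def)
        then have ar: "of_nat ?p ^ Suc e dvd a r" by (intro key) (simp add: e_def)
        have "of_nat ?p ^ Suc v dvd a r"
        proof (cases "v \<le> ?n")
          case True
          then show ?thesis using ar by (simp add: e_def)
        next
          case False
          then have "a r = 0"
            using ar N pol_p_power_eq_0[of "Suc e", where 'k='k and 'n='n and 'd='d]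
            by (simp add: e_def del: power_Suc)
          then show ?thesis by simp
        qed
        moreover have "multi_val ?p r + 1 = enat (Suc v)" by (simp add: j(1) v_def one_enat_def)
        ultimately show ?thesis by (simp add: ppow_ideal_def)
      qed
    qed
  qed
qed

theorem corollary5p12:
  fixes \<theta> :: "('d::{finite,linorder}, 'k::field_prime_char) pol \<Rightarrow> ('d, 'k) pol"
  assumes perfect: "\<forall>x::'k. \<exists>y. y ^ CHAR('k) = x"
    and \<theta>: "\<theta> \<in> pol_diff_ops"
  shows
    "(\<exists>(c :: ('d \<Rightarrow>\<^sub>0 nat) \<Rightarrow> ('d, ('k, 'n::finite) witt) pol) D.
        finite {r. c r \<noteq> 0} \<and> (\<forall>j r. is_divided_lift j r (D j r)) \<and> is_lift (op_sum c D) \<theta>)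
   \<and> (\<forall>(c :: ('d \<Rightarrow>\<^sub>0 nat) \<Rightarrow> ('d, ('k, 'n) witt) pol) D D' R.
        finite {r. c r \<noteq> 0}
          \<longrightarrow> (\<forall>j r. is_divided_lift j r (D j r)) \<longrightarrow> (\<forall>j r. is_divided_lift j r (D' j r))
          \<longrightarrow> is_lift (op_sum c D) \<theta>
          \<longrightarrow> is_restriction (op_sum c D) R \<longrightarrow> is_restriction (op_sum c D') R)
   \<and> (\<forall>(\<delta>1 :: ('d, ('k, 'n) witt) pol \<Rightarrow> ('d, ('k, 'n) witt) pol) \<delta>2 a R.
        is_lift \<delta>1 \<theta> \<longrightarrow> is_lift \<delta>2 \<theta>
          \<longrightarrow> finite {r. a r \<noteq> 0} \<longrightarrow> (\<lambda>f. \<delta>1 f - \<delta>2 f) = op_sum a divided_partial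
          \<longrightarrow> is_restriction (\<lambda>f. \<delta>1 f - \<delta>2 f) R
          \<longrightarrow> (R = (\<lambda>x. 0)) = (\<forall>r. a r \<in> ppow_ideal CHAR('k) (multi_val CHAR('k) r + 1)))"
proof (intro conjI allI impI)
  obtain c :: "('d \<Rightarrow>\<^sub>0 nat) \<Rightarrow> ('d, ('k, 'n) witt) pol"
    where "finite {r. c r \<noteq> 0}" "is_lift (op_sum c divided_partial) \<theta>"
    using ex_divided_lift[OF \<theta>] by blast
  then show "\<exists>(c :: ('d \<Rightarrow>\<^sub>0 nat) \<Rightarrow> ('d, ('k, 'n) witt) pol) D.
      finite {r. c r \<noteq> 0} \<and> (\<forall>j r. is_divided_lift j r (D j r)) \<and> is_lift (op_sum c D) \<theta>"
    using divided_partial_is_divided_lift by blast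
next
  fix c :: "('d \<Rightarrow>\<^sub>0 nat) \<Rightarrow> ('d, ('k, 'n) witt) pol"
    and D D' :: "'d \<Rightarrow> nat \<Rightarrow> ('d, ('k, 'n) witt) pol \<Rightarrow> ('d, ('k, 'n) witt) pol" and R
  assume "\<forall>j r. is_divided_lift j r (D j r)" "\<forall>j r. is_divided_lift j r (D' j r)"
    "is_restriction (op_sum c D) R"
  then show "is_restriction (op_sum c D') R"
    using is_restriction_op_sum_divided_lift[OF perfect] by blast
next
  fix \<delta>1 \<delta>2 :: "('d, ('k, 'n) witt) pol \<Rightarrow> ('d, ('k, 'n) witt) pol" and a R
  assume fin: "finite {r. a r \<noteq> 0}" and eq: "(\<lambda>f. \<delta>1 f - \<delta>2 f) = op_sum a divided_partial"
    and R: "is_restriction (\<lambda>f. \<delta>1 f - \<delta>2 f) R"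
  have "ghost_map (R x) = op_sum a divided_partial (ghost_map x)" for x
    using R unfolding eq is_restriction_def by blast
  then have "R x = 0 \<longleftrightarrow> op_sum a divided_partial (ghost_map x) = 0" for x
    using ghost_map_eq_0[OF perfect] ghost_map_zero[OF perfect, where 'd='d and 'n='n] by metis
  then have "R = (\<lambda>x. 0) \<longleftrightarrow> (\<forall>x. op_sum a divided_partial (ghost_map x) = 0)" by (simp only: fun_eq_iff)
  then show "(R = (\<lambda>x. 0)) = (\<forall>r. a r \<in> ppow_ideal CHAR('k) (multi_val CHAR('k) r + 1))"
    unfolding op_sum_annihilates_ghost_iff[OF perfect fin] .
qed

end
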